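(* Let $f\in X_0'$, let $(h_j)_j\subset\mathcal{H}$ be a sequence and $h\in\mathcal{H}$ such that $h_j\rightharpoonup h$ weakly-$\ast$ in $L^\infty(\mathbb{R}^N\times\mathbb{R}^N)$. Let $u_j\in X_0$ be the solution of $(P_{h_j})$ and $u\in X_0$ the solution of $(P_h)$, all with the same right-hand side $f$. Then there exists a subsequence of indices (not relabelled) along which $$u_j\to u\quad\text{strongly in }L^p(\mathbb{R}^N)$$ and $$\lim_{j}\ \min_{w\in X_0}\left\{\frac1p B_{h_j}(w,w)-\langle f,w\rangle\right\}=\min_{w\in X_0}\left\{\frac1p B_h(w,w)-\langle f,w\rangle\right\}.$$ In particular, along this subsequence, $$\lim_j B_{h_j}(u_j,u_j)=B_h(u,u).$$
   Context: Let $\Omega\subset\mathbb{R}^N$ be a bounded open smooth domain and let $1<p<\infty$. Let $k$ be a radial and positive function in $L^1(\mathbb{R}^N)$ (written $k(|z|)$, $z\in\mathbb{R}^N$) such that $\int_{\mathbb{R}^N\setminus B(0,\epsilon)}\frac{k(|z|)}{|z|^p}\,dz<\infty$ for every $\epsilon>0$, where $B(0,\epsilon)$ is the open ball of radius $\epsilon$ centred at $0$, and $k(|z|)\ge \frac{c_0}{|z|^{N+(s-1)p}}$ for all $z\in\mathbb{R}^N\setminus\{0\}$, where $c_0>0$ and $s\in(0,1)$ are given constants. Put $B(w,w)=\int_{\mathbb{R}^N}\int_{\mathbb{R}^N}k(|x'-x|)\frac{|w(x')-w(x)|^p}{|x'-x|^p}\,dx'dx$, $X=\{w\in L^p(\mathbb{R}^N):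 B(w,w)<\infty\}$ and $X_0=\{w\in X: w=0\text{ a.e. in }\mathbb{R}^N\setminus\Omega\}$, normed by $\|w\|_{X_0}=B(w,w)^{1/p}$ (equivalent on $X_0$ to $\|w\|_{L^p(\mathbb{R}^N)}+B(w,w)^{1/p}$). $X_0'$ is its dual and $\langle\cdot,\cdot\rangle$ the duality pairing between $X_0'$ and $X_0$. All functions are real-valued. Fix constants $0<h_{\min}<h_{\max}$; $\mathcal{H}$ is the set of $h\in L^\infty(\mathbb{R}^N\times\mathbb{R}^N)$ with $h(x',x)=h(x,x')\in[h_{\min},h_{\max}]$ for a.e. $(x',x)$. For $h\in\mathcal{H}$ and $u,v\in X_0$, $$B_h(u,v)=\int_{\mathbb{R}^N}\int_{\mathbb{R}^N}h(x',x)\,k(|x'-x|)\,\frac{|u(x')-u(x)|^{p-2}(u(x')-u(x))(v(x')-v(x))}{|x'-x|^p}\,dx'dx .$$ Given $f\in X_0'$, the solution of problem $(P_h)$ is the unique $u\in X_0$ such that $B_h(u,v)=\langle f,v\rangle$ for all $v\in X_0$; it is also the unique minimizer over $X_0$ of $w\mapsto\frac1pB_h(w,w)-\langle f,w\rangle$.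
   Formalization: The assumption k in L^1(R^N) is replaced by integrability of k(|z|) on every ball, because L^1(R^N) contradicts the lower bound k(|z|) >= c0/|z|^{N+(s-1)p} for all z ≠ 0, which is not integrable at infinity; all else is as stated. *)

theory Defs
  imports "HOL-Analysis.Analysis"
begin

text \<open>
  The space \<open>\<real>\<^sup>N\<close> is an arbitrary type \<open>'a\<close> of class \<open>euclidean_space\<close>, with \<open>N = DIM('a)\<close>.
  Elements of \<open>L\<^sup>p\<close>, \<open>X\<close> and \<open>X\<^sub>0\<close> are functions, not equivalence classes, so all notions below are
  insensitive to changes on null sets. Double integrals over \<open>\<real>\<^sup>N \<times> \<real>\<^sup>N\<close> are integrals with respect
  to the Lebesgue measure on \<open>'a \<times> 'a\<close>, the pair being \<open>(x', x)\<close>.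
\<close>

primrec Ck :: "nat \<Rightarrow> ('a::euclidean_space \<Rightarrow> real) \<Rightarrow> bool" where
  "Ck 0 g \<longleftrightarrow> continuous_on UNIV g"
| "Ck (Suc m) g \<longleftrightarrow>
     (\<exists>D. (\<forall>x. (g has_derivative (\<lambda>v. \<Sum>b\<in>Basis. (v \<bullet> b) * D b x)) (at x)) \<and>
          (\<forall>b\<in>Basis. Ck m (D b)))"

text \<open>
  The boundary is locally the graph of a smooth function: \<open>\<nu>\<close> is the direction of the last axis after
  a rotation of coordinates, and \<open>\<gamma>\<close> is only evaluated on the hyperplane orthogonal to \<open>\<nu>\<close>.
\<close>

definition smooth_domain :: "'a::euclidean_space set \<Rightarrow> bool" where
  "smooth_domain \<Omega> \<longleftrightarrow>
     open \<Omega> \<and> connected \<Omega> \<and> \<Omega> \<noteq> {} \<and>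
     (\<forall>x0\<in>frontier \<Omega>. \<exists>r>0. \<exists>\<nu> \<gamma>. norm \<nu> = 1 \<and> (\<forall>m. Ck m \<gamma>) \<and>
        \<Omega> \<inter> ball x0 r = {x \<in> ball x0 r. \<gamma> (x - (x \<bullet> \<nu>) *\<^sub>R \<nu>) < x \<bullet> \<nu>})"

definition Lp_space :: "real \<Rightarrow> ('a::euclidean_space \<Rightarrow> real) set" where
  "Lp_space p =
     {w. w \<in> borel_measurable lebesgue \<and> integrable lebesgue (\<lambda>x. \<bar>w x\<bar> powr p)}"

definition Lp_norm :: "real \<Rightarrow> ('a::euclidean_space \<Rightarrow> real) \<Rightarrow> real" where
  "Lp_norm p w = (LINT x|lebesgue. \<bar>w x\<bar> powr p) powr (1 / p)"

definition Linf_space :: "('b::euclidean_space \<Rightarrow> real) set" where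
  "Linf_space = {g. g \<in> borel_measurable lebesgue \<and> (\<exists>C. AE x in lebesgue. \<bar>g x\<bar> \<le> C)}"

definition weak_star_Linf :: "(nat \<Rightarrow> 'b::euclidean_space \<Rightarrow> real) \<Rightarrow> ('b \<Rightarrow> real) \<Rightarrow> bool" where
  "weak_star_Linf g g0 \<longleftrightarrow>
     (\<forall>\<phi>. integrable lebesgue \<phi> \<longrightarrow>
        (\<lambda>j. LINT x|lebesgue. g j x * \<phi> x) \<longlonglongrightarrow> (LINT x|lebesgue. g0 x * \<phi> x))"

text \<open>
  The radial kernel is given by its profile \<open>k\<close> on the half-line. Its value at \<open>0\<close> is immaterial
  and unconstrained, as the kernel may be singular at the origin. Integrability is required on
  balls only (\<open>L\<^sup>1\<close> locally): every kernel in \<open>L\<^sup>1(\<real>\<^sup>N)\<close> qualifies, but requiring \<open>L\<^sup>1(\<real>\<^sup>N)\<close> would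
  contradict the global lower bound, whose right-hand side \<open>c0 |z| powr (-N + (1 - s) p)\<close> is not
  integrable at infinity. The fractional kernel, with equality in the lower bound, is admissible.
\<close>

definition admissible_kernel ::
  "'a::euclidean_space itself \<Rightarrow> real \<Rightarrow> real \<Rightarrow> real \<Rightarrow> (real \<Rightarrow> real) \<Rightarrow> bool" where
  "admissible_kernel _ p s c0 k \<longleftrightarrow>
     (\<forall>z::'a. z \<noteq> 0 \<longrightarrow> 0 < k (norm z)) \<and>
     (\<forall>R>0. set_integrable lebesgue (ball (0::'a) R) (\<lambda>z. k (norm z))) \<and>
     (\<forall>\<epsilon>>0. set_integrable lebesgue (- ball (0::'a) \<epsilon>) (\<lambda>z. k (norm z) / norm z powr p)) \<and>
     (\<forall>z::'a. z \<noteq> 0 \<longrightarrow> c0 / norm z powr (real DIM('a) + (s - 1) * p) \<le> k (norm z))"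

text \<open>\<open>B(w,w)\<close>, possibly infinite.\<close>

definition seminorm_pow ::
  "real \<Rightarrow> (real \<Rightarrow> real) \<Rightarrow> ('a::euclidean_space \<Rightarrow> real) \<Rightarrow> ennreal" where
  "seminorm_pow p k w =
     (\<integral>\<^sup>+(x', x). ennreal (k (norm (x' - x)) * (\<bar>w x' - w x\<bar> powr p / norm (x' - x) powr p)) \<partial>lebesgue)"

definition X_space :: "real \<Rightarrow> (real \<Rightarrow> real) \<Rightarrow> ('a::euclidean_space \<Rightarrow> real) set" where
  "X_space p k = {w \<in> Lp_space p. seminorm_pow p k w < \<infinity>}"

definition X0_space ::
  "real \<Rightarrow> (real \<Rightarrow> real) \<Rightarrow> 'a::euclidean_space set \<Rightarrow> ('a \<Rightarrow> real) set" where
  "X0_space p k \<Omega> = {w \<in> X_space p k. AE x in lebesgue. x \<notin> \<Omega> \<longrightarrow> w x = 0}"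

definition X0_norm :: "real \<Rightarrow> (real \<Rightarrow> real) \<Rightarrow> ('a::euclidean_space \<Rightarrow> real) \<Rightarrow> real" where
  "X0_norm p k w = enn2real (seminorm_pow p k w) powr (1 / p)"

text \<open>
  The pairing \<open>\<langle>f, w\<rangle>\<close> is the application \<open>f w\<close>. Boundedness forces \<open>f\<close> to take equal values on
  members of \<open>X\<^sub>0\<close> that agree almost everywhere; values outside \<open>X\<^sub>0\<close> are irrelevant.
\<close>

definition X0_dual ::
  "real \<Rightarrow> (real \<Rightarrow> real) \<Rightarrow> 'a::euclidean_space set \<Rightarrow> (('a \<Rightarrow> real) \<Rightarrow> real) set" where
  "X0_dual p k \<Omega> =
     {f. (\<forall>v\<in>X0_space p k \<Omega>. \<forall>w\<in>X0_space p k \<Omega>. f (\<lambda>x. v x + w x) = f v + f w) \<and>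
         (\<forall>c. \<forall>w\<in>X0_space p k \<Omega>. f (\<lambda>x. c * w x) = c * f w) \<and>
         (\<exists>C. \<forall>w\<in>X0_space p k \<Omega>. \<bar>f w\<bar> \<le> C * X0_norm p k w)}"

definition H_class :: "real \<Rightarrow> real \<Rightarrow> ('a::euclidean_space \<times> 'a \<Rightarrow> real) set" where
  "H_class hmin hmax =
     {h \<in> Linf_space.
        AE (x', x) in lebesgue. h (x', x) = h (x, x') \<and> hmin \<le> h (x', x) \<and> h (x', x) \<le> hmax}"

text \<open>
  \<open>B\<^sub>h(u,v)\<close>. Since \<open>0 powr a = 0\<close> and \<open>t / 0 = 0\<close>, the integrand vanishes where
  \<open>u x' = u x\<close> (also for \<open>p < 2\<close>) and on the diagonal, which is a null set.
\<close>

definition B_form ::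
  "real \<Rightarrow> (real \<Rightarrow> real) \<Rightarrow> ('a::euclidean_space \<times> 'a \<Rightarrow> real) \<Rightarrow>
   ('a \<Rightarrow> real) \<Rightarrow> ('a \<Rightarrow> real) \<Rightarrow> real" where
  "B_form p k h u v =
     integral\<^sup>L lebesgue (\<lambda>(x', x).
       h (x', x) * k (norm (x' - x)) *
       (\<bar>u x' - u x\<bar> powr (p - 2) * (u x' - u x) * (v x' - v x) / norm (x' - x) powr p))"

definition is_solution ::
  "real \<Rightarrow> (real \<Rightarrow> real) \<Rightarrow> 'a::euclidean_space set \<Rightarrow> ('a \<times> 'a \<Rightarrow> real) \<Rightarrow>
   (('a \<Rightarrow> real) \<Rightarrow> real) \<Rightarrow> ('a \<Rightarrow> real) \<Rightarrow> bool" where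
  "is_solution p k \<Omega> h f u \<longleftrightarrow>
     u \<in> X0_space p k \<Omega> \<and> (\<forall>v\<in>X0_space p k \<Omega>. B_form p k h u v = f v)"

definition energy ::
  "real \<Rightarrow> (real \<Rightarrow> real) \<Rightarrow> ('a::euclidean_space \<times> 'a \<Rightarrow> real) \<Rightarrow>
   (('a \<Rightarrow> real) \<Rightarrow> real) \<Rightarrow> ('a \<Rightarrow> real) \<Rightarrow> real" where
  "energy p k h f w = 1 / p * B_form p k h w w - f w"

definition is_minimum :: "('b \<Rightarrow> real) \<Rightarrow> 'b set \<Rightarrow> real \<Rightarrow> bool" where
  "is_minimum F S m \<longleftrightarrow> (\<exists>w\<in>S. F w = m) \<and> (\<forall>w\<in>S. m \<le> F w)"

end

theory Submission
  imports Defs "HOL-Complex_Analysis.Great_Picard"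
begin

text \<open>
  Write \<open>D w (x', x) = w x' - w x\<close> and let \<open>M\<close> be Lebesgue measure on pairs weighted by
  \<open>k(|x' - x|) / |x' - x| powr p\<close>. Then \<open>B(w,w)\<close> is the \<open>p\<close>-th power of the norm of \<open>D w\<close> in \<open>L\<^sup>p(M)\<close>,
  and \<open>B\<^sub>h(u,v)\<close> is the \<open>M\<close>-integral of \<open>h \<Phi>(D u) D v\<close> with \<open>\<Phi>(t) = |t| powr (p - 2) * t\<close>.
  The coefficients \<open>h\<^sub>j\<close> converge only weakly-* and enter the equation as a factor of \<open>\<Phi>(D u\<^sub>j)\<close>, so the
  passage to the limit needs almost everywhere convergence of \<open>D u\<^sub>j\<close>. Unlike a gradient, \<open>D u\<^sub>j\<close>
  inherits it from \<open>u\<^sub>j\<close> itself, and this is what makes the nonlocal problem stable under weak-*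
  limits of the coefficients.

  Convergence of a subsequence of \<open>u\<^sub>j\<close> in \<open>L\<^sup>p\<close> and almost everywhere, to some \<open>v\<close>, comes from compactness.
  Testing \<open>(P\<^sub>h\<^sub>j)\<close> with \<open>u\<^sub>j\<close> bounds \<open>B(u\<^sub>j,u\<^sub>j)\<close>; the lower bound on the kernel turns this into a bound
  of the Gagliardo seminorm of order \<open>s\<close>; and functions supported in a fixed bounded set with bounded
  Gagliardo seminorm are precompact in \<open>L\<^sup>p\<close> (\<open>gagliardo_compact\<close>). For the latter, \<open>\<real>\<^sup>N\<close> is cut into cubes of
  side \<open>\<delta>\<close>: a function differs in \<open>L\<^sup>p\<close> from its cube averages by at most a multiple of \<open>\<delta> powr s\<close>
  times its seminorm, and
  there are only finitely many averages (\<open>Lp_le_gagliardo_plus_means\<close>).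

  The limit is identified by monotonicity (\<open>flux_limit_identification\<close>). The equations of \<open>u\<^sub>j\<close> and \<open>u\<close>, tested
  with \<open>u\<^sub>j - u\<close>, give
  \<open>\<integral> h\<^sub>j (\<Phi>(D u\<^sub>j) - \<Phi>(D u)) (D u\<^sub>j - D u) dM = \<integral> (h - h\<^sub>j) \<Phi>(D u) (D u\<^sub>j - D u) dM\<close>.
  Since \<open>D u\<^sub>j\<close> is bounded in \<open>L\<^sup>p(M)\<close> and converges almost everywhere, \<open>\<Phi>(D u) D u\<^sub>j\<close> converges strongly in
  \<open>L\<^sup>1(M)\<close> to \<open>\<Phi>(D u) D v\<close>, so weak-* convergence makes the right-hand side vanish in the limit. The integrand
  on the left is nonnegative; by Fatou and strict monotonicity of \<open>\<Phi>\<close>, \<open>D v = D u\<close> almost everywhere, and the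
  Poincare inequality gives \<open>v = u\<close>.

  Finally, since \<open>u\<close> solves \<open>(P\<^sub>h)\<close>, the functional itself is \<open>\<langle>f, w\<rangle> = B\<^sub>h(u, w)\<close>, so the same \<open>L\<^sup>1(M)\<close> convergence
  yields \<open>\<langle>f, u\<^sub>j\<rangle> \<rightarrow> \<langle>f, u\<rangle>\<close>. Everything else
  is a function of this number: \<open>B\<^sub>h\<^sub>j(u\<^sub>j,u\<^sub>j) = \<langle>f, u\<^sub>j\<rangle>\<close>, and by Young's inequality (\<open>flux_test_energy_le\<close>)
  \<open>u\<^sub>j\<close> is a minimizer, with minimum \<open>(1/p - 1) \<langle>f, u\<^sub>j\<rangle>\<close>.
\<close>

section \<open>The nonlinearity and its integrals\<close>

text \<open>
  The derivative of \<open>|t| powr p / p\<close>: the nonlinearity of the \<open>p\<close>-Laplacian.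
\<close>

definition p_flux :: "real \<Rightarrow> real \<Rightarrow> real" where
  "p_flux p t = \<bar>t\<bar> powr (p - 2) * t"

lemma p_flux_mult_self: "p_flux p t * t = \<bar>t\<bar> powr p"
proof (cases "t = 0")
  case False
  have "\<bar>t\<bar> powr (p - 2) * t * t = \<bar>t\<bar> powr (p - 2) * \<bar>t\<bar> powr 2"
    using False by (simp add: power2_eq_square)
  also have "\<dots> = \<bar>t\<bar> powr p"
    by (subst powr_add[symmetric]) simp
  finally show ?thesis by (simp add: p_flux_def)
qed (simp add: p_flux_def)

lemma abs_p_flux: "\<bar>p_flux p t\<bar> = \<bar>t\<bar> powr (p - 1)"
proof (cases "t = 0")
  case False
  have "\<bar>t\<bar> powr (p - 1) = \<bar>t\<bar> powr (p - 2) * \<bar>t\<bar> powr 1"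
    by (subst powr_add[symmetric]) simp
  with False show ?thesis by (simp add: p_flux_def abs_mult)
qed (simp add: p_flux_def)

lemma p_flux_minus: "p_flux p (- t) = - p_flux p t"
  by (simp add: p_flux_def)

lemma p_flux_nonneg: "t \<ge> 0 \<Longrightarrow> p_flux p t = t powr (p - 1)"
  using abs_p_flux[of p t] by (simp add: p_flux_def)

text \<open>
  \<open>p_flux p\<close> is the odd extension of the increasing function \<open>t powr (p - 1)\<close>.
\<close>

lemma p_flux_strict_mono:
  assumes "1 < p" "a < b" shows "p_flux p a < p_flux p b"
proof -
  have *: "p_flux p x < p_flux p y" if "0 \<le> x" "x < y" for x y
    using that assms powr_less_mono2[of "p-1" x y] by (simp add: p_flux_nonneg)
  consider "0 \<le> a" | "b \<le> 0" | "a < 0" "0 < b" by linarith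
  then show ?thesis
  proof cases
    case 1 then show ?thesis using * assms by blast
  next
    case 2 then show ?thesis using *[of "-b" "-a"] assms by (simp add: p_flux_minus)
  next
    case 3
    then have "p_flux p 0 < p_flux p b" "p_flux p a < p_flux p 0"
      using *[of 0 b] *[of 0 "-a"] by (auto simp: p_flux_minus) (simp add: p_flux_def)
    then show ?thesis by simp
  qed
qed

lemma p_flux_monotone_mult:
  assumes "1 < p"
  shows "0 \<le> (p_flux p a - p_flux p b) * (a - b)"
    and "(p_flux p a - p_flux p b) * (a - b) = 0 \<longleftrightarrow> a = b"
  using p_flux_strict_mono[OF assms, of a b] p_flux_strict_mono[OF assms, of b a]
  by (cases a b rule: linorder_cases; auto simp: mult_neg_neg less_imp_le)+

text \<open>
  At \<open>l = 0\<close> and \<open>p < 2\<close> the factor \<open>|t| powr (p - 2)\<close> blows up; continuity there is read off from the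
  modulus \<open>|t| powr (p - 1)\<close>.
\<close>

lemma tendsto_p_flux:
  assumes "1 < p" and X: "(X \<longlongrightarrow> l) F"
  shows "((\<lambda>x. p_flux p (X x)) \<longlongrightarrow> p_flux p l) F"
proof (cases "l = 0")
  case True
  have "((\<lambda>x. \<bar>X x\<bar> powr (p - 1)) \<longlongrightarrow> \<bar>l\<bar> powr (p - 1)) F"
    using assms by (intro tendsto_powr' tendsto_intros X) auto
  then have "((\<lambda>x. \<bar>p_flux p (X x)\<bar>) \<longlongrightarrow> 0) F"
    using True by (simp add: abs_p_flux)
  then show ?thesis using True by (simp add: tendsto_rabs_zero_iff p_flux_def)
next
  case False
  then show ?thesis unfolding p_flux_def
    by (intro tendsto_intros X) auto
qed

lemma borel_measurable_p_flux [measurable (raw)]: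
  "g \<in> borel_measurable M \<Longrightarrow> (\<lambda>x. p_flux p (g x)) \<in> borel_measurable M"
  unfolding p_flux_def by measurable

lemma Young_flux:
  assumes "1 < p"
  shows "p_flux p a * b \<le> (1 - 1 / p) * \<bar>a\<bar> powr p + \<bar>b\<bar> powr p / p"
proof -
  define q where "q = p / (p - 1)"
  have q: "1 < q" "1 / q + 1 / p = 1" "1 / q = 1 - 1 / p" "(p - 1) * q = p"
    using assms by (auto simp: q_def field_simps)
  have "p_flux p a * b \<le> \<bar>a\<bar> powr (p - 1) * \<bar>b\<bar>"
    by (metis abs_ge_self abs_mult abs_p_flux)
  also have "\<dots> \<le> (\<bar>a\<bar> powr (p - 1)) powr q / q + \<bar>b\<bar> powr p / p"
    using q assms by (intro Youngs_inequality) auto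
  also have "(\<bar>a\<bar> powr (p - 1)) powr q / q = (1 - 1 / p) * \<bar>a\<bar> powr p"
    unfolding q(3)[symmetric] powr_powr q(4) by simp
  finally show ?thesis .
qed

text \<open>
  A weighted Young inequality: if \<open>|a| powr (p - 1) \<le> \<epsilon> |b| powr (p - 1)\<close> the first term on the right suffices,
  otherwise \<open>|b|\<close> is at most a multiple of \<open>|a|\<close> and the second does.
\<close>

lemma power_mult_le_split:
  fixes a b \<epsilon> :: real
  assumes "1 < p" "0 < \<epsilon>"
  shows "\<bar>a\<bar> powr (p - 1) * \<bar>b\<bar> \<le> \<epsilon> * \<bar>b\<bar> powr p + \<epsilon> powr (- 1 / (p - 1)) * \<bar>a\<bar> powr p"
proof -
  have mul: "\<bar>x\<bar> powr (p - 1) * \<bar>x\<bar> = \<bar>x\<bar> powr p" for x :: real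
    by (metis abs_abs abs_p_flux abs_mult p_flux_mult_self powr_ge_zero abs_of_nonneg)
  show ?thesis
  proof (cases "\<bar>a\<bar> powr (p - 1) \<le> \<epsilon> * \<bar>b\<bar> powr (p - 1)")
    case True
    then have "\<bar>a\<bar> powr (p - 1) * \<bar>b\<bar> \<le> \<epsilon> * \<bar>b\<bar> powr (p - 1) * \<bar>b\<bar>"
      by (intro mult_right_mono) auto
    also have "\<dots> = \<epsilon> * \<bar>b\<bar> powr p" using mul[of b] by (simp add: mult.assoc)
    finally show ?thesis by (smt (verit) powr_ge_zero mult_nonneg_nonneg)
  next
    case False
    then have "\<bar>b\<bar> powr (p - 1) \<le> \<bar>a\<bar> powr (p - 1) / \<epsilon>"
      using assms by (simp add: field_simps)
    then have "(\<bar>b\<bar> powr (p - 1)) powr (1 / (p - 1)) \<le> (\<bar>a\<bar> powr (p - 1) / \<epsilon>) powr (1 / (p - 1))"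
      using assms by (intro powr_mono2) auto
    then have "\<bar>b\<bar> \<le> \<epsilon> powr (- 1 / (p - 1)) * \<bar>a\<bar>"
      using assms by (simp add: powr_powr powr_divide powr_minus_divide mult.commute)
    then have "\<bar>a\<bar> powr (p - 1) * \<bar>b\<bar> \<le> \<bar>a\<bar> powr (p - 1) * (\<epsilon> powr (- 1 / (p - 1)) * \<bar>a\<bar>)"
      by (intro mult_left_mono) auto
    also have "\<dots> = \<epsilon> powr (- 1 / (p - 1)) * \<bar>a\<bar> powr p"
      using mul[of a] by (simp add: mult_ac)
    finally show ?thesis using assms by (smt (verit) powr_ge_zero mult_nonneg_nonneg)
  qed
qed

lemma powr_add_le:
  fixes a b :: real
  assumes "0 \<le> p"
  shows "\<bar>a + b\<bar> powr p \<le> 2 powr p * (\<bar>a\<bar> powr p + \<bar>b\<bar> powr p)"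
proof -
  have "\<bar>a + b\<bar> powr p \<le> (2 * max \<bar>a\<bar> \<bar>b\<bar>) powr p"
    using assms by (intro powr_mono2) auto
  also have "\<dots> = 2 powr p * max \<bar>a\<bar> \<bar>b\<bar> powr p"
    by (simp add: powr_mult)
  also have "\<dots> \<le> 2 powr p * (\<bar>a\<bar> powr p + \<bar>b\<bar> powr p)"
    by (intro mult_left_mono) (auto simp: max_def)
  finally show ?thesis .
qed

corollary powr_diff_le:
  fixes a b :: real
  assumes "0 \<le> p"
  shows "\<bar>a - b\<bar> powr p \<le> 2 powr p * (\<bar>a\<bar> powr p + \<bar>b\<bar> powr p)"
  using powr_add_le[OF assms, of a "-b"] by simp

lemma integrable_flux_mult:
  fixes F G :: "'b \<Rightarrow> real"
  assumes p: "1 < p" and [measurable]: "F \<in> borel_measurable M" "G \<in> borel_measurable M"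
    and F: "integrable M (\<lambda>x. \<bar>F x\<bar> powr p)" and G: "integrable M (\<lambda>x. \<bar>G x\<bar> powr p)"
  shows "integrable M (\<lambda>x. p_flux p (F x) * G x)"
proof (rule Bochner_Integration.integrable_bound[OF Bochner_Integration.integrable_add[OF G F]])
  show "AE x in M. norm (p_flux p (F x) * G x) \<le> norm (\<bar>G x\<bar> powr p + \<bar>F x\<bar> powr p)"
    using power_mult_le_split[OF p, of 1 "F x" "G x" for x]
    by (auto simp: abs_mult abs_p_flux)
qed auto

lemma integrable_bounded_mult:
  fixes h f :: "'b \<Rightarrow> real"
  assumes "integrable M f" "h \<in> borel_measurable M" and h: "AE x in M. \<bar>h x\<bar> \<le> C"
  shows "integrable M (\<lambda>x. h x * f x)"
proof (rule Bochner_Integration.integrable_bound)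
  show "integrable M (\<lambda>x. C * f x)" using assms by simp
  show "AE x in M. norm (h x * f x) \<le> norm (C * f x)"
    using h by eventually_elim (auto simp: abs_mult intro!: mult_right_mono)
qed (use assms in measurable)

text \<open>
  By Fatou's lemma. It makes the differences \<open>F\<^sub>j - F\<^sub>s\<close> bounded in \<open>L\<^sup>p\<close> as well.
\<close>

lemma integrable_powr_limit:
  fixes Fs :: "'b \<Rightarrow> real" and Fj :: "nat \<Rightarrow> 'b \<Rightarrow> real"
  assumes p: "1 < p"
    and [measurable]: "Fs \<in> borel_measurable M" "\<And>j. Fj j \<in> borel_measurable M"
    and Fj: "\<And>j. integrable M (\<lambda>x. \<bar>Fj j x\<bar> powr p)"
    and C: "\<And>j. (LINT x|M. \<bar>Fj j x\<bar> powr p) \<le> C"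
    and lim: "AE x in M. (\<lambda>j. Fj j x) \<longlonglongrightarrow> Fs x"
  shows "integrable M (\<lambda>x. \<bar>Fs x\<bar> powr p)" and "(LINT x|M. \<bar>Fs x\<bar> powr p) \<le> C"
proof -
  have C0: "0 \<le> C" using C[of 0] by (smt (verit) integral_nonneg_AE powr_ge_zero AE_I2)
  have "(\<integral>\<^sup>+x. ennreal (\<bar>Fs x\<bar> powr p) \<partial>M) = (\<integral>\<^sup>+x. liminf (\<lambda>j. ennreal (\<bar>Fj j x\<bar> powr p)) \<partial>M)"
  proof (rule nn_integral_cong_AE)
    show "AE x in M. ennreal (\<bar>Fs x\<bar> powr p) = liminf (\<lambda>j. ennreal (\<bar>Fj j x\<bar> powr p))"
      using lim
    proof eventually_elim
      case (elim x)
      have "(\<lambda>j. ennreal (\<bar>Fj j x\<bar> powr p)) \<longlonglongrightarrow> ennreal (\<bar>Fs x\<bar> powr p)"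
        using p by (intro tendsto_ennrealI tendsto_powr' tendsto_intros elim) auto
      then show ?case by (rule lim_imp_Liminf[OF trivial_limit_sequentially, symmetric])
    qed
  qed
  also have "\<dots> \<le> liminf (\<lambda>j. \<integral>\<^sup>+x. ennreal (\<bar>Fj j x\<bar> powr p) \<partial>M)"
    by (intro nn_integral_liminf) auto
  also have "\<dots> \<le> liminf (\<lambda>j::nat. ennreal C)"
    using Fj C by (intro Liminf_mono always_eventually allI)
      (auto simp: nn_integral_eq_integral intro!: ennreal_leI)
  finally have le: "(\<integral>\<^sup>+x. ennreal (\<bar>Fs x\<bar> powr p) \<partial>M) \<le> ennreal C"
    by (simp add: Liminf_const)
  show I: "integrable M (\<lambda>x. \<bar>Fs x\<bar> powr p)"
    using le by (intro integrableI_nonneg) (auto simp: less_top[symmetric] top_unique)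
  show "(LINT x|M. \<bar>Fs x\<bar> powr p) \<le> C"
    using le C0 by (subst (asm) nn_integral_eq_integral[OF I]) auto
qed

text \<open>
  The product of a fixed \<open>L\<^sup>p\<^sup>/\<^sup>(\<^sup>p\<^sup>-\<^sup>1\<^sup>)\<close> function with an \<open>L\<^sup>p\<close>-bounded sequence that tends to zero almost everywhere
  tends to zero in \<open>L\<^sup>1\<close>. The weighted Young inequality bounds the product by \<open>\<epsilon> |H\<^sub>j| powr p\<close>, whose integral is
  small uniformly in \<open>j\<close>, up to an excess dominated by a multiple of \<open>|F| powr p\<close>, to which dominated
  convergence applies.
\<close>

lemma tendsto_integral_powr_mult_zero:
  fixes F :: "'b \<Rightarrow> real" and H :: "nat \<Rightarrow> 'b \<Rightarrow> real"
  assumes p: "1 < p"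
    and [measurable]: "F \<in> borel_measurable M" "\<And>j. H j \<in> borel_measurable M"
    and F: "integrable M (\<lambda>x. \<bar>F x\<bar> powr p)"
    and H: "\<And>j. integrable M (\<lambda>x. \<bar>H j x\<bar> powr p)"
    and C: "\<And>j. (LINT x|M. \<bar>H j x\<bar> powr p) \<le> C"
    and lim: "AE x in M. (\<lambda>j. H j x) \<longlonglongrightarrow> 0"
  shows "(\<lambda>j. LINT x|M. \<bar>F x\<bar> powr (p - 1) * \<bar>H j x\<bar>) \<longlonglongrightarrow> 0"
proof (rule LIMSEQ_I)
  fix e :: real assume e: "0 < e"
  have C0: "0 \<le> C" using C[of 0] by (smt (verit) integral_nonneg_AE powr_ge_zero AE_I2)
  \<comment> \<open>\<open>C + 1\<close> keeps the denominator positive when \<open>C = 0\<close>.\<close>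
  define \<epsilon> where "\<epsilon> = e / (2 * (C + 1))"
  have \<epsilon>: "0 < \<epsilon>" "\<epsilon> * C \<le> e / 2" using e C0 by (auto simp: \<epsilon>_def field_simps)
  define c where "c = \<epsilon> powr (- 1 / (p - 1))"
  define f where "f j x = max 0 (\<bar>F x\<bar> powr (p - 1) * \<bar>H j x\<bar> - \<epsilon> * \<bar>H j x\<bar> powr p)" for j x
  have [measurable]: "f j \<in> borel_measurable M" for j unfolding f_def by measurable
  have f_le: "f j x \<le> c * \<bar>F x\<bar> powr p" for j x
    using power_mult_le_split[OF p \<epsilon>(1), of "F x" "H j x"] by (auto simp: f_def c_def)
  have FHi: "integrable M (\<lambda>x. \<bar>F x\<bar> powr (p - 1) * \<bar>H j x\<bar>)" for j
    using integrable_norm[OF integrable_flux_mult[OF p _ _ F H]] by (simp add: abs_mult abs_p_flux)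
  have dom: "integrable M (\<lambda>x. c * \<bar>F x\<bar> powr p)" using F by simp
  have fi: "integrable M (f j)" for j
    by (rule Bochner_Integration.integrable_bound[OF dom])
      (use f_le in \<open>auto simp: f_def intro!: AE_I2 intro: order_trans[OF _ abs_ge_self]\<close>)
  have "(\<lambda>j. LINT x|M. f j x) \<longlonglongrightarrow> (LINT x|M. 0)"
  proof (rule integral_dominated_convergence[where w="\<lambda>x. c * \<bar>F x\<bar> powr p"])
    show "AE x in M. (\<lambda>j. f j x) \<longlonglongrightarrow> 0"
      using lim
    proof eventually_elim
      case (elim x)
      have "(\<lambda>j. f j x) \<longlonglongrightarrow> max 0 (\<bar>F x\<bar> powr (p - 1) * \<bar>0\<bar> - \<epsilon> * \<bar>0\<bar> powr p)"
        unfolding f_def using p by (intro tendsto_max tendsto_intros tendsto_powr' elim) auto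
      then show ?case by simp
    qed
    show "AE x in M. norm (f j x) \<le> c * \<bar>F x\<bar> powr p" for j
      using f_le[of j] by (auto simp: f_def)
  qed (use dom in auto)
  then have "(\<lambda>j. LINT x|M. f j x) \<longlonglongrightarrow> 0" by simp
  then obtain N where N: "\<And>j. j \<ge> N \<Longrightarrow> \<bar>LINT x|M. f j x\<bar> < e / 2"
    using LIMSEQ_D[of _ 0 "e/2"] e by fastforce
  show "\<exists>N. \<forall>j\<ge>N. norm ((LINT x|M. \<bar>F x\<bar> powr (p - 1) * \<bar>H j x\<bar>) - 0) < e"
  proof (intro exI allI impI)
    fix j assume j: "j \<ge> N"
    have "(LINT x|M. \<bar>F x\<bar> powr (p - 1) * \<bar>H j x\<bar>) \<le> (LINT x|M. f j x + \<epsilon> * \<bar>H j x\<bar> powr p)"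
      by (rule integral_mono) (use FHi fi H in \<open>auto simp: f_def\<close>)
    also have "\<dots> = (LINT x|M. f j x) + \<epsilon> * (LINT x|M. \<bar>H j x\<bar> powr p)"
      using fi H by (subst Bochner_Integration.integral_add) auto
    also have "\<dots> \<le> (LINT x|M. f j x) + \<epsilon> * C"
      using C \<epsilon> by (intro add_left_mono mult_left_mono) auto
    also have "\<dots> < e" using N[OF j] \<epsilon> by auto
    finally show "norm ((LINT x|M. \<bar>F x\<bar> powr (p - 1) * \<bar>H j x\<bar>) - 0) < e"
      by (simp add: integral_nonneg_AE)
  qed
qed

text \<open>
  The coefficients \<open>h\<^sub>j\<close> are merely bounded: strong \<open>L\<^sup>1\<close> convergence of \<open>\<Phi>(F) F\<^sub>j\<close> absorbs them. Applied both to
  the weakly-* convergent sequence and to a constant one.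
\<close>

lemma tendsto_integral_flux_mult:
  fixes F Fs :: "'b \<Rightarrow> real" and Fj h :: "nat \<Rightarrow> 'b \<Rightarrow> real"
  assumes p: "1 < p"
    and [measurable]: "F \<in> borel_measurable M" "Fs \<in> borel_measurable M"
      "\<And>j. Fj j \<in> borel_measurable M" "\<And>j. h j \<in> borel_measurable M"
    and h: "\<And>j. AE x in M. \<bar>h j x\<bar> \<le> D"
    and F: "integrable M (\<lambda>x. \<bar>F x\<bar> powr p)"
    and Fj: "\<And>j. integrable M (\<lambda>x. \<bar>Fj j x\<bar> powr p)"
    and C: "\<And>j. (LINT x|M. \<bar>Fj j x\<bar> powr p) \<le> C"
    and lim: "AE x in M. (\<lambda>j. Fj j x) \<longlonglongrightarrow> Fs x"
  shows "(\<lambda>j. (LINT x|M. h j x * (p_flux p (F x) * (Fj j x - Fs x)))) \<longlonglongrightarrow> 0"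
proof -
  note Fs = integrable_powr_limit[OF p _ _ Fj C lim, simplified]
  define H where "H j x = Fj j x - Fs x" for j x
  have [measurable]: "H j \<in> borel_measurable M" for j unfolding H_def by measurable
  have Hle: "\<bar>H j x\<bar> powr p \<le> 2 powr p * (\<bar>Fj j x\<bar> powr p + \<bar>Fs x\<bar> powr p)" for j x
    unfolding H_def using p by (intro powr_diff_le) auto
  have dom: "integrable M (\<lambda>x. 2 powr p * (\<bar>Fj j x\<bar> powr p + \<bar>Fs x\<bar> powr p))" for j
    using Fj Fs by auto
  have Hi: "integrable M (\<lambda>x. \<bar>H j x\<bar> powr p)" for j
    by (rule Bochner_Integration.integrable_bound[OF dom]) (use Hle in auto)
  have HC: "(LINT x|M. \<bar>H j x\<bar> powr p) \<le> 2 powr p * (C + C)" for j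
  proof -
    have "(LINT x|M. \<bar>H j x\<bar> powr p) \<le> (LINT x|M. 2 powr p * (\<bar>Fj j x\<bar> powr p + \<bar>Fs x\<bar> powr p))"
      by (rule integral_mono[OF Hi dom Hle])
    also have "\<dots> = 2 powr p * ((LINT x|M. \<bar>Fj j x\<bar> powr p) + (LINT x|M. \<bar>Fs x\<bar> powr p))"
      using Fj Fs by simp
    also have "\<dots> \<le> 2 powr p * (C + C)" using Fs C[of j] by (intro mult_left_mono add_mono) auto
    finally show ?thesis .
  qed
  have H0: "AE x in M. (\<lambda>j. H j x) \<longlonglongrightarrow> 0"
    using lim by eventually_elim (simp add: H_def LIM_zero)
  note main = tendsto_integral_powr_mult_zero[OF p _ _ F Hi HC H0]
  have i: "integrable M (\<lambda>x. p_flux p (F x) * H j x)" for j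
    by (rule integrable_flux_mult[OF p _ _ F Hi]) auto
  have "norm (LINT x|M. h j x * (p_flux p (F x) * H j x))
      \<le> D * (LINT x|M. \<bar>F x\<bar> powr (p - 1) * \<bar>H j x\<bar>)" for j
  proof -
    have ai: "integrable M (\<lambda>x. D * (\<bar>F x\<bar> powr (p - 1) * \<bar>H j x\<bar>))"
      using integrable_norm[OF i, of j] by (simp add: abs_mult abs_p_flux)
    have hi: "integrable M (\<lambda>x. norm (h j x * (p_flux p (F x) * H j x)))"
      by (intro integrable_norm integrable_bounded_mult[OF i _ h]) auto
    have "norm (LINT x|M. h j x * (p_flux p (F x) * H j x))
        \<le> (LINT x|M. norm (h j x * (p_flux p (F x) * H j x)))"
      by (rule integral_norm_bound)
    also have "\<dots> \<le> (LINT x|M. D * (\<bar>F x\<bar> powr (p - 1) * \<bar>H j x\<bar>))"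
    proof (rule integral_mono_AE[OF hi ai])
      show "AE x in M. norm (h j x * (p_flux p (F x) * H j x)) \<le> D * (\<bar>F x\<bar> powr (p - 1) * \<bar>H j x\<bar>)"
        using h[of j] by eventually_elim (auto simp: abs_mult abs_p_flux intro!: mult_right_mono)
    qed
    finally show ?thesis by simp
  qed
  then have le: "\<forall>\<^sub>F j in sequentially. norm (LINT x|M. h j x * (p_flux p (F x) * H j x))
      \<le> D * (LINT x|M. \<bar>F x\<bar> powr (p - 1) * \<bar>H j x\<bar>)"
    by (intro always_eventually allI)
  show ?thesis
    unfolding H_def[symmetric]
    by (rule Lim_null_comparison[OF le tendsto_mult_right_zero[OF main]]) auto
qed

section \<open>Monotonicity, completeness and convexity on a measure space\<close>

text \<open>
  The abstract core of the stability result, with \<open>F\<close>, \<open>F\<^sub>j\<close> in the role of \<open>D u\<close>, \<open>D u\<^sub>j\<close>. Both integrals in \<open>test_Fj\<close>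
  represent \<open>\<langle>f, u\<^sub>j\<rangle>\<close>, and both in \<open>test_F\<close> represent \<open>\<langle>f, u\<rangle>\<close>. They reduce the integral of
  \<open>h\<^sub>j (\<Phi>(F\<^sub>j) - \<Phi>(F)) (F\<^sub>j - F)\<close> to terms containing only the fixed function \<open>\<Phi>(F)\<close>, in which weak-*
  convergence of \<open>h\<^sub>j\<close> meets strong convergence of the other factor.
\<close>

lemma flux_limit_identification:
  fixes F Fs h :: "'b \<Rightarrow> real" and Fj hj :: "nat \<Rightarrow> 'b \<Rightarrow> real"
  assumes p: "1 < p" and hmin: "0 < hmin"
    and [measurable]: "F \<in> borel_measurable M" "Fs \<in> borel_measurable M"
      "\<And>j. Fj j \<in> borel_measurable M" "\<And>j. hj j \<in> borel_measurable M" "h \<in> borel_measurable M"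
    and hj: "\<And>j. AE x in M. hmin \<le> hj j x \<and> hj j x \<le> hmax"
    and h: "AE x in M. hmin \<le> h x \<and> h x \<le> hmax"
    and F: "integrable M (\<lambda>x. \<bar>F x\<bar> powr p)"
    and Fj: "\<And>j. integrable M (\<lambda>x. \<bar>Fj j x\<bar> powr p)"
    and C: "\<And>j. (LINT x|M. \<bar>Fj j x\<bar> powr p) \<le> C"
    and lim: "AE x in M. (\<lambda>j. Fj j x) \<longlonglongrightarrow> Fs x"
    and weak: "\<And>\<phi>. integrable M \<phi> \<Longrightarrow>
      (\<lambda>j. LINT x|M. hj j x * \<phi> x) \<longlonglongrightarrow> (LINT x|M. h x * \<phi> x)"
    and test_Fj: "\<And>j. (LINT x|M. hj j x * (p_flux p (Fj j x) * Fj j x))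
      = (LINT x|M. h x * (p_flux p (F x) * Fj j x))"
    and test_F: "\<And>j. (LINT x|M. hj j x * (p_flux p (Fj j x) * F x))
      = (LINT x|M. h x * (p_flux p (F x) * F x))"
  shows "AE x in M. Fs x = F x"
proof -
  have hjD: "AE x in M. \<bar>hj j x\<bar> \<le> hmax" for j
    using hj[of j] by eventually_elim (use hmin in auto)
  have hD: "AE x in M. \<bar>h x\<bar> \<le> hmax"
    using h by eventually_elim (use hmin in auto)
  note Fs = integrable_powr_limit(1)[OF p _ _ Fj C lim, simplified]
  define G where "G j x = (p_flux p (Fj j x) - p_flux p (F x)) * (Fj j x - F x)" for j x
  define Gs where "Gs x = (p_flux p (Fs x) - p_flux p (F x)) * (Fs x - F x)" for x
  have [measurable]: "G j \<in> borel_measurable M" "Gs \<in> borel_measurable M" for j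
    unfolding G_def Gs_def by measurable
  have G0: "0 \<le> G j x" for j x unfolding G_def by (rule p_flux_monotone_mult[OF p])
  note int = integrable_flux_mult[OF p _ _ F F, simplified] integrable_flux_mult[OF p _ _ F Fs, simplified]
    integrable_flux_mult[OF p _ _ F Fj, simplified] integrable_flux_mult[OF p _ _ Fj F, simplified]
    integrable_flux_mult[OF p _ _ Fj Fj, simplified]
  note hint = int[THEN integrable_bounded_mult[OF _ _ hD, simplified], simplified]
  note hjint = int[THEN integrable_bounded_mult[OF _ _ hjD, simplified], simplified]
  have Gi: "integrable M (\<lambda>x. hj j x * G j x)" for j
    unfolding G_def using hjint by (simp add: algebra_simps)
  have phi: "integrable M (\<lambda>x. p_flux p (F x) * (Fs x - F x))"
    using int by (simp add: algebra_simps)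
  \<comment> \<open>Inserting \<open>Fs\<close> separates strong convergence (first two terms) from weak-* convergence (the rest).\<close>
  have split: "(LINT x|M. hj j x * G j x) =
      (LINT x|M. h x * (p_flux p (F x) * (Fj j x - Fs x)))
      - (LINT x|M. hj j x * (p_flux p (F x) * (Fj j x - Fs x)))
      + ((LINT x|M. h x * (p_flux p (F x) * (Fs x - F x)))
      - (LINT x|M. hj j x * (p_flux p (F x) * (Fs x - F x))))" for j
  proof -
    have "(LINT x|M. hj j x * G j x) =
        (LINT x|M. hj j x * (p_flux p (Fj j x) * Fj j x))
        - (LINT x|M. hj j x * (p_flux p (Fj j x) * F x))
        - (LINT x|M. hj j x * (p_flux p (F x) * Fj j x))
        + (LINT x|M. hj j x * (p_flux p (F x) * F x))"
      unfolding G_def using hjint by (simp add: algebra_simps)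
    moreover have "(LINT x|M. h x * (p_flux p (F x) * (Fj j x - Fs x))) =
        (LINT x|M. h x * (p_flux p (F x) * Fj j x)) - (LINT x|M. h x * (p_flux p (F x) * Fs x))"
      "(LINT x|M. hj j x * (p_flux p (F x) * (Fj j x - Fs x))) =
        (LINT x|M. hj j x * (p_flux p (F x) * Fj j x)) - (LINT x|M. hj j x * (p_flux p (F x) * Fs x))"
      "(LINT x|M. h x * (p_flux p (F x) * (Fs x - F x))) =
        (LINT x|M. h x * (p_flux p (F x) * Fs x)) - (LINT x|M. h x * (p_flux p (F x) * F x))"
      "(LINT x|M. hj j x * (p_flux p (F x) * (Fs x - F x))) =
        (LINT x|M. hj j x * (p_flux p (F x) * Fs x)) - (LINT x|M. hj j x * (p_flux p (F x) * F x))"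
      using hjint hint by (simp_all add: algebra_simps)
    ultimately show ?thesis using test_Fj[of j] test_F[of j] by simp
  qed
  have t1: "(\<lambda>j. LINT x|M. h x * (p_flux p (F x) * (Fj j x - Fs x))) \<longlonglongrightarrow> 0"
    by (rule tendsto_integral_flux_mult[OF p _ _ _ _ hD F Fj C lim]) auto
  have t2: "(\<lambda>j. LINT x|M. hj j x * (p_flux p (F x) * (Fj j x - Fs x))) \<longlonglongrightarrow> 0"
    by (rule tendsto_integral_flux_mult[OF p _ _ _ _ hjD F Fj C lim]) auto
  have to0: "(\<lambda>j. LINT x|M. hj j x * G j x) \<longlonglongrightarrow> 0"
    unfolding split
    using tendsto_add[OF tendsto_diff[OF t1 t2] tendsto_diff[OF tendsto_const weak[OF phi],
      of "LINT x|M. h x * (p_flux p (F x) * (Fs x - F x))"]] by simp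
  \<comment> \<open>Fatou with the constant \<open>hmin\<close> in place of \<open>h\<^sub>j\<close>, which has no pointwise limit.\<close>
  have "(\<integral>\<^sup>+x. ennreal (hmin * Gs x) \<partial>M) = (\<integral>\<^sup>+x. liminf (\<lambda>j. ennreal (hmin * G j x)) \<partial>M)"
  proof (rule nn_integral_cong_AE)
    show "AE x in M. ennreal (hmin * Gs x) = liminf (\<lambda>j. ennreal (hmin * G j x))"
      using lim
    proof eventually_elim
      case (elim x)
      have "(\<lambda>j. ennreal (hmin * G j x)) \<longlonglongrightarrow> ennreal (hmin * Gs x)"
        unfolding G_def Gs_def using p
        by (intro tendsto_ennrealI tendsto_intros tendsto_p_flux elim) auto
      then show ?case by (rule lim_imp_Liminf[OF trivial_limit_sequentially, symmetric])
    qed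
  qed
  also have "\<dots> \<le> liminf (\<lambda>j. \<integral>\<^sup>+x. ennreal (hmin * G j x) \<partial>M)"
    by (intro nn_integral_liminf) auto
  also have "\<dots> \<le> liminf (\<lambda>j. ennreal (LINT x|M. hj j x * G j x))"
  proof (intro Liminf_mono always_eventually allI)
    fix j
    have nn: "AE x in M. 0 \<le> hj j x * G j x"
      using hj[of j] by eventually_elim (use hmin G0 in auto)
    have "(\<integral>\<^sup>+x. ennreal (hmin * G j x) \<partial>M) \<le> (\<integral>\<^sup>+x. ennreal (hj j x * G j x) \<partial>M)"
    proof (rule nn_integral_mono_AE)
      show "AE x in M. ennreal (hmin * G j x) \<le> ennreal (hj j x * G j x)"
        using hj[of j] by eventually_elim (use G0 in \<open>auto intro!: ennreal_leI mult_right_mono\<close>)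
    qed
    also have "\<dots> = ennreal (LINT x|M. hj j x * G j x)"
      by (rule nn_integral_eq_integral[OF Gi nn])
    finally show "(\<integral>\<^sup>+x. ennreal (hmin * G j x) \<partial>M) \<le> ennreal (LINT x|M. hj j x * G j x)" .
  qed
  also have "\<dots> = 0"
    using tendsto_ennrealI[OF to0] by (simp add: lim_imp_Liminf)
  finally have "(\<integral>\<^sup>+x. ennreal (hmin * Gs x) \<partial>M) = 0" by simp
  then have "AE x in M. ennreal (hmin * Gs x) = 0"
    by (subst (asm) nn_integral_0_iff_AE) auto
  then show ?thesis
  proof eventually_elim
    case (elim x)
    have "0 \<le> Gs x" unfolding Gs_def by (rule p_flux_monotone_mult[OF p])
    with elim hmin have "Gs x = 0"
      by (metis ennreal_eq_0_iff mult_le_0_iff not_less order_antisym)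
    then show ?case unfolding Gs_def by (simp only: p_flux_monotone_mult(2)[OF p])
  qed
qed

text \<open>
  Solutions minimize the energy: with the functional written as the form tested by \<open>G\<close>, minimality is
  Young's inequality \<open>\<Phi>(F) G \<le> (1 - 1/p) |F| powr p + |G| powr p / p\<close>, integrated against \<open>h \<ge> 0\<close>.
\<close>

lemma flux_test_energy_le:
  fixes F G h :: "'b \<Rightarrow> real"
  assumes p: "1 < p"
    and [measurable]: "F \<in> borel_measurable M" "G \<in> borel_measurable M" "h \<in> borel_measurable M"
    and h: "AE x in M. 0 \<le> h x \<and> h x \<le> D"
    and F: "integrable M (\<lambda>x. \<bar>F x\<bar> powr p)" and G: "integrable M (\<lambda>x. \<bar>G x\<bar> powr p)"
  shows "1 / p * (LINT x|M. h x * (p_flux p (F x) * F x)) - (LINT x|M. h x * (p_flux p (F x) * F x))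
    \<le> 1 / p * (LINT x|M. h x * (p_flux p (G x) * G x)) - (LINT x|M. h x * (p_flux p (F x) * G x))"
proof -
  have hD: "AE x in M. \<bar>h x\<bar> \<le> D" using h by eventually_elim auto
  have int: "integrable M (\<lambda>x. h x * (p_flux p (F x) * F x))"
    "integrable M (\<lambda>x. h x * (p_flux p (F x) * G x))"
    "integrable M (\<lambda>x. h x * (p_flux p (G x) * G x))"
    by (intro integrable_bounded_mult[OF _ _ hD] integrable_flux_mult[OF p] F G; simp)+
  have "(LINT x|M. h x * (p_flux p (F x) * G x))
      \<le> (LINT x|M. (1 - 1 / p) * (h x * (p_flux p (F x) * F x)) + 1 / p * (h x * (p_flux p (G x) * G x)))"
  proof (rule integral_mono_AE)
    show "AE x in M. h x * (p_flux p (F x) * G x)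
        \<le> (1 - 1 / p) * (h x * (p_flux p (F x) * F x)) + 1 / p * (h x * (p_flux p (G x) * G x))"
      using h
    proof eventually_elim
      case (elim x)
      then have "h x * (p_flux p (F x) * G x) \<le> h x * ((1 - 1 / p) * \<bar>F x\<bar> powr p + \<bar>G x\<bar> powr p / p)"
        by (intro mult_left_mono Young_flux p) auto
      then show ?case unfolding p_flux_mult_self by (simp add: algebra_simps)
    qed
  qed (use int in auto)
  also have "\<dots> = (1 - 1 / p) * (LINT x|M. h x * (p_flux p (F x) * F x))
      + 1 / p * (LINT x|M. h x * (p_flux p (G x) * G x))"
    using int by simp
  finally show ?thesis by (simp add: algebra_simps)
qed

text \<open>
  Completeness of \<open>L\<^sup>p\<close>, stated for functions. Along a subsequence with consecutive distances
  \<open>\<integral> |w\<^sub>n\<^sub>+\<^sub>1 - w\<^sub>n| powr p \<le> (c/2) ^ n\<close>, where \<open>c = 2 powr (-p)\<close>, the series of the integrands over \<open>c ^ n\<close> is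
  integrable, hence finite almost everywhere, which forces \<open>|w\<^sub>n\<^sub>+\<^sub>1 - w\<^sub>n| \<le> const / 2 ^ n\<close> pointwise.
\<close>

lemma Lp_Cauchy_convergent_subsequence:
  fixes w :: "nat \<Rightarrow> 'b \<Rightarrow> real"
  assumes p: "0 < p" and [measurable]: "\<And>j. w j \<in> borel_measurable M"
    and Cauchy: "\<And>e. 0 < e \<Longrightarrow>
      \<exists>N. \<forall>i\<ge>N. \<forall>j\<ge>N. (\<integral>\<^sup>+x. ennreal (\<bar>w i x - w j x\<bar> powr p) \<partial>M) \<le> ennreal e"
  shows "\<exists>r v. strict_mono (r::nat \<Rightarrow> nat) \<and> v \<in> borel_measurable M \<and>
      (AE x in M. (\<lambda>j. w (r j) x) \<longlonglongrightarrow> v x) \<and>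
      (\<lambda>j. \<integral>\<^sup>+x. ennreal (\<bar>w (r j) x - v x\<bar> powr p) \<partial>M) \<longlonglongrightarrow> 0"
proof -
  define c where "c = (2::real) powr (- p)"
  have c: "0 < c" "c < 1" using p by (auto simp: c_def powr_less_one)
  define e where "e n = (c / 2) ^ n" for n :: nat
  have e: "0 < e n" for n using c by (simp add: e_def)
  from Cauchy[OF e] obtain N where
    N: "\<And>n i j. i \<ge> N n \<Longrightarrow> j \<ge> N n \<Longrightarrow> (\<integral>\<^sup>+x. ennreal (\<bar>w i x - w j x\<bar> powr p) \<partial>M) \<le> ennreal (e n)"
    by metis
  define r where "r = rec_nat (N 0) (\<lambda>n m. max (Suc m) (N (Suc n)))"
  have r_Suc: "r (Suc n) = max (Suc (r n)) (N (Suc n))" for n by (simp add: r_def)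
  have r: "strict_mono r" by (rule strict_monoI_Suc) (simp add: r_Suc)
  have rN: "N n \<le> r n" for n by (cases n) (simp_all add: r_def)
  define d where "d n x = \<bar>w (r (Suc n)) x - w (r n) x\<bar> powr p" for n x
  have [measurable]: "d n \<in> borel_measurable M" for n unfolding d_def by measurable
  have d_le: "(\<integral>\<^sup>+x. ennreal (d n x) \<partial>M) \<le> ennreal (e n)" for n
    unfolding d_def using rN[of n] r_Suc[of n] by (intro N) auto
  have "(\<integral>\<^sup>+x. (\<Sum>n. ennreal (d n x / c ^ n)) \<partial>M) = (\<Sum>n. \<integral>\<^sup>+x. ennreal (d n x / c ^ n) \<partial>M)"
    by (rule nn_integral_suminf) measurable
  also have "\<dots> \<le> (\<Sum>n. ennreal ((1 / 2) ^ n))"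
  proof (intro suminf_le allI)
    fix n
    have "(\<integral>\<^sup>+x. ennreal (d n x / c ^ n) \<partial>M) = (\<integral>\<^sup>+x. ennreal (1 / c ^ n) * ennreal (d n x) \<partial>M)"
      using c by (intro nn_integral_cong) (simp flip: ennreal_mult')
    also have "\<dots> = ennreal (1 / c ^ n) * (\<integral>\<^sup>+x. ennreal (d n x) \<partial>M)"
      by (rule nn_integral_cmult) measurable
    also have "\<dots> \<le> ennreal (1 / c ^ n) * ennreal (e n)"
      by (intro mult_left_mono d_le) auto
    also have "\<dots> = ennreal ((1 / 2) ^ n)"
      using c by (simp add: e_def power_divide flip: ennreal_mult')
    finally show "(\<integral>\<^sup>+x. ennreal (d n x / c ^ n) \<partial>M) \<le> ennreal ((1 / 2) ^ n)" .
  qed auto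
  also have "\<dots> < \<infinity>"
    by (subst suminf_ennreal_eq[OF _ summable_sums]) (auto simp: less_top[symmetric])
  finally have fin: "(\<integral>\<^sup>+x. (\<Sum>n. ennreal (d n x / c ^ n)) \<partial>M) \<noteq> \<infinity>" by simp
  have "AE x in M. (\<Sum>n. ennreal (d n x / c ^ n)) \<noteq> \<infinity>"
    by (rule nn_integral_PInf_AE[OF _ fin]) measurable
  then have conv: "AE x in M. convergent (\<lambda>j. w (r j) x)"
  proof eventually_elim
    case (elim x)
    then obtain S where S: "0 \<le> S" "(\<Sum>n. ennreal (d n x / c ^ n)) = ennreal S"
      by (cases "(\<Sum>n. ennreal (d n x / c ^ n))") auto
    have bound: "\<bar>w (r (Suc n)) x - w (r n) x\<bar> \<le> S powr (1 / p) * (1 / 2) ^ n" for n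
    proof -
      have "ennreal (d n x / c ^ n) \<le> ennreal S"
        using sum_le_suminf[of "\<lambda>n. ennreal (d n x / c ^ n)" "{n}"] S by simp
      then have "d n x \<le> S * c ^ n" using S c by (simp add: field_simps)
      then have "d n x powr (1 / p) \<le> (S * c ^ n) powr (1 / p)"
        using p by (intro powr_mono2) (auto simp: d_def)
      also have "\<dots> = S powr (1 / p) * (c powr (1 / p)) ^ n"
        using S c by (simp add: powr_mult powr_power powr_powr flip: powr_realpow)
      also have "c powr (1 / p) = 1 / 2"
        unfolding c_def powr_powr using p by (simp add: powr_minus_divide)
      finally show ?thesis using p by (simp add: d_def powr_powr)
    qed
    have "summable (\<lambda>n. w (r (Suc n)) x - w (r n) x)"
    proof (rule summable_comparison_test')
      show "summable (\<lambda>n. S powr (1 / p) * (1 / 2) ^ n)"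
        by (intro summable_mult summable_geometric) auto
    qed (use bound in auto)
    then obtain L where "(\<lambda>n. w (r n) x - w (r 0) x) \<longlonglongrightarrow> L"
      by (auto simp: summable_def sums_def sum_lessThan_telescope[where f="\<lambda>n. w (r n) x"])
    from tendsto_add[OF this tendsto_const[of "w (r 0) x"]] show ?case
      by (auto simp: convergent_def)
  qed
  define v where "v x = lim (\<lambda>j. w (r j) x)" for x
  have v [measurable]: "v \<in> borel_measurable M" unfolding v_def by measurable
  have lim: "AE x in M. (\<lambda>j. w (r j) x) \<longlonglongrightarrow> v x"
    using conv by eventually_elim (simp add: v_def convergent_LIMSEQ_iff)
  have v_le: "(\<integral>\<^sup>+x. ennreal (\<bar>w (r n) x - v x\<bar> powr p) \<partial>M) \<le> ennreal (e n)" for n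
  proof -
    have "(\<integral>\<^sup>+x. ennreal (\<bar>w (r n) x - v x\<bar> powr p) \<partial>M)
        = (\<integral>\<^sup>+x. liminf (\<lambda>j. ennreal (\<bar>w (r n) x - w (r j) x\<bar> powr p)) \<partial>M)"
    proof (rule nn_integral_cong_AE)
      show "AE x in M. ennreal (\<bar>w (r n) x - v x\<bar> powr p)
          = liminf (\<lambda>j. ennreal (\<bar>w (r n) x - w (r j) x\<bar> powr p))"
        using lim
      proof eventually_elim
        case (elim x)
        have "(\<lambda>j. ennreal (\<bar>w (r n) x - w (r j) x\<bar> powr p)) \<longlonglongrightarrow> ennreal (\<bar>w (r n) x - v x\<bar> powr p)"
          using p by (intro tendsto_ennrealI tendsto_powr' tendsto_intros elim) auto
        then show ?case by (rule lim_imp_Liminf[OF trivial_limit_sequentially, symmetric])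
      qed
    qed
    also have "\<dots> \<le> liminf (\<lambda>j. \<integral>\<^sup>+x. ennreal (\<bar>w (r n) x - w (r j) x\<bar> powr p) \<partial>M)"
      by (intro nn_integral_liminf) auto
    also have "\<dots> \<le> liminf (\<lambda>j::nat. ennreal (e n))"
    proof (rule Liminf_mono)
      show "\<forall>\<^sub>F j in sequentially. (\<integral>\<^sup>+x. ennreal (\<bar>w (r n) x - w (r j) x\<bar> powr p) \<partial>M) \<le> ennreal (e n)"
        using eventually_ge_at_top[of n]
      proof eventually_elim
        case (elim j)
        then have "r n \<le> r j" using r by (simp add: strict_mono_less_eq)
        then show ?case using rN[of n] by (intro N) auto
      qed
    qed
    finally show ?thesis by (simp add: Liminf_const)
  qed
  have "e \<longlonglongrightarrow> 0" unfolding e_def using c by (intro LIMSEQ_realpow_zero) auto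
  from tendsto_ennrealI[OF this] have e0: "(\<lambda>n. ennreal (e n)) \<longlonglongrightarrow> 0" by simp
  have lower: "\<forall>\<^sub>F n in sequentially. 0 \<le> (\<integral>\<^sup>+x. ennreal (\<bar>w (r n) x - v x\<bar> powr p) \<partial>M)" by simp
  have upper: "\<forall>\<^sub>F n in sequentially. (\<integral>\<^sup>+x. ennreal (\<bar>w (r n) x - v x\<bar> powr p) \<partial>M) \<le> ennreal (e n)"
    by (intro always_eventually allI v_le)
  from tendsto_sandwich[OF lower upper tendsto_const e0]
  show ?thesis using r v lim by blast
qed

text \<open>
  Integrate Young's inequality for \<open>\<Phi>(c) g\<close> with \<open>c\<close> the mean of \<open>g\<close>: its left-hand side has integral
  \<open>m |c| powr p\<close>, part of which is absorbed.
\<close>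

lemma Jensen_powr:
  fixes g :: "'b \<Rightarrow> real"
  assumes p: "1 < p" and "finite_measure M" and m: "m = measure M (space M)" "0 < m"
    and g: "integrable M g"
  shows "ennreal (m * \<bar>(LINT x|M. g x) / m\<bar> powr p) \<le> (\<integral>\<^sup>+x. ennreal (\<bar>g x\<bar> powr p) \<partial>M)"
proof (cases "(\<integral>\<^sup>+x. ennreal (\<bar>g x\<bar> powr p) \<partial>M) = \<infinity>")
  case False
  interpret finite_measure M by fact
  have [measurable]: "g \<in> borel_measurable M" using g by simp
  have gi: "integrable M (\<lambda>x. \<bar>g x\<bar> powr p)"
    using False by (intro integrableI_nonneg) (auto simp: less_top)
  define c where "c = (LINT x|M. g x) / m"
  have "(LINT x|M. p_flux p c * g x) \<le> (LINT x|M. (1 - 1 / p) * \<bar>c\<bar> powr p + \<bar>g x\<bar> powr p / p)"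
    using g gi by (intro integral_mono Young_flux p) auto
  also have "\<dots> = (1 - 1 / p) * \<bar>c\<bar> powr p * m + (LINT x|M. \<bar>g x\<bar> powr p) / p"
    using gi m by simp
  also have "(LINT x|M. p_flux p c * g x) = m * \<bar>c\<bar> powr p"
    using m unfolding p_flux_mult_self[symmetric] by (simp add: c_def)
  finally have "m * \<bar>c\<bar> powr p \<le> (LINT x|M. \<bar>g x\<bar> powr p)"
    using p by (simp add: field_simps)
  then show ?thesis
    by (subst nn_integral_eq_integral[OF gi]) (auto simp: c_def intro!: ennreal_leI)
qed simp

section \<open>Pairs of points, cubes and the Gagliardo seminorm\<close>

text \<open>
  For \<open>a = DIM('a) + s * p\<close> this is the \<open>p\<close>-th power of the Gagliardo seminorm of order \<open>s\<close>.
\<close>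

definition gagliardo :: "real \<Rightarrow> real \<Rightarrow> ('a::euclidean_space \<Rightarrow> real) \<Rightarrow> ennreal" where
  "gagliardo a p w = (\<integral>\<^sup>+(x, y). ennreal (\<bar>w x - w y\<bar> powr p / norm (x - y) powr a) \<partial>lborel)"

text \<open>
  On pairs at distance at most \<open>D\<close> the singular weight is at least \<open>D powr (-a)\<close>. Taking \<open>S\<close> a product with a set
  far from the support gives the Poincare inequality, and \<open>S\<close> the pairs in a common cube the cube estimate.
\<close>

lemma nn_integral_close_pairs_le:
  fixes w :: "'a::euclidean_space \<Rightarrow> real" and S :: "('a \<times> 'a) set"
  assumes a: "0 \<le> a" and [measurable]: "w \<in> borel_measurable borel" "S \<in> sets borel"
    and S: "\<And>x y. (x, y) \<in> S \<Longrightarrow> norm (x - y) \<le> D"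
  shows "(\<integral>\<^sup>+x. \<integral>\<^sup>+y. ennreal (\<bar>w x - w y\<bar> powr p) * indicator S (x, y) \<partial>lborel \<partial>lborel)
    \<le> ennreal (D powr a) * gagliardo a p w"
proof -
  have m: "(\<lambda>z::'a\<times>'a. ennreal (\<bar>w (fst z) - w (snd z)\<bar> powr p) * indicator S z) \<in> borel_measurable (lborel \<Otimes>\<^sub>M lborel)"
    unfolding lborel_prod by (simp add: borel_prod[symmetric]) (measurable; simp add: borel_prod)
  have "(\<integral>\<^sup>+x. \<integral>\<^sup>+y. ennreal (\<bar>w x - w y\<bar> powr p) * indicator S (x, y) \<partial>lborel \<partial>lborel)
      = (\<integral>\<^sup>+z. ennreal (\<bar>w (fst z) - w (snd z)\<bar> powr p) * indicator S z \<partial>lborel)"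
    using lborel.nn_integral_fst[OF m] by (simp add: lborel_prod)
  also have "\<dots> \<le> (\<integral>\<^sup>+z. ennreal (D powr a) *
      ennreal (\<bar>w (fst z) - w (snd z)\<bar> powr p / norm (fst z - snd z) powr a) \<partial>lborel)"
  proof (rule nn_integral_mono)
    fix z :: "'a \<times> 'a"
    show "ennreal (\<bar>w (fst z) - w (snd z)\<bar> powr p) * indicator S z \<le> ennreal (D powr a) *
        ennreal (\<bar>w (fst z) - w (snd z)\<bar> powr p / norm (fst z - snd z) powr a)"
    proof (cases "z \<in> S \<and> fst z \<noteq> snd z")
      case True
      then have "norm (fst z - snd z) powr a \<le> D powr a"
        using S[of "fst z" "snd z"] a by (intro powr_mono2) auto
      then have "\<bar>w (fst z) - w (snd z)\<bar> powr p * norm (fst z - snd z) powr a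
          \<le> \<bar>w (fst z) - w (snd z)\<bar> powr p * D powr a"
        by (intro mult_left_mono) auto
      then have "\<bar>w (fst z) - w (snd z)\<bar> powr p
          \<le> D powr a * (\<bar>w (fst z) - w (snd z)\<bar> powr p / norm (fst z - snd z) powr a)"
        using True by (simp add: field_simps)
      then show ?thesis
        using True by (simp add: ennreal_leI flip: ennreal_mult')
    qed (auto simp: indicator_def)
  qed
  also have "\<dots> = ennreal (D powr a) * gagliardo a p w"
  proof -
    have m': "(\<lambda>z::'a\<times>'a. ennreal (\<bar>w (fst z) - w (snd z)\<bar> powr p / norm (fst z - snd z) powr a)) \<in> borel_measurable lborel"
      by (simp add: borel_prod[symmetric])
    show ?thesis unfolding gagliardo_def
      by (subst nn_integral_cmult[OF m']) (simp add: case_prod_unfold)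
  qed
  finally show ?thesis .
qed

text \<open>
  For \<open>x\<close> in \<open>\<Omega>\<close> and \<open>y\<close> in a ball disjoint from \<open>\<Omega>\<close>, \<open>w x = w x - w y\<close>; average over \<open>y\<close>.
\<close>

lemma Poincare_gagliardo:
  fixes \<Omega> :: "'a::euclidean_space set"
  assumes \<Omega>: "bounded \<Omega>" and a: "0 \<le> a"
  shows "\<exists>C\<ge>0. \<forall>w\<in>borel_measurable borel. (\<forall>x. x \<notin> \<Omega> \<longrightarrow> w x = 0) \<longrightarrow>
    (\<integral>\<^sup>+x. ennreal (\<bar>w x\<bar> powr p) \<partial>lborel) \<le> ennreal C * gagliardo a p w"
proof -
  obtain R where R: "0 < R" "\<And>x. x \<in> \<Omega> \<Longrightarrow> norm x < R"
    using \<Omega> by (metis bounded_pos_less)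
  obtain b :: 'a where b: "b \<in> Basis" using nonempty_Basis by blast
  \<comment> \<open>At distances between \<open>2 R\<close> and \<open>4 R\<close> from the origin, while \<open>\<Omega>\<close> lies within distance \<open>R\<close>.\<close>
  define A where "A = ball ((3 * R) *\<^sub>R b) R"
  have A_norm: "norm y < 4 * R" "2 * R < norm y" if "y \<in> A" for y
  proof -
    have n: "norm ((3 * R) *\<^sub>R b) = 3 * R" using b R by simp
    have "norm (y - (3 * R) *\<^sub>R b) < R" using that by (simp add: A_def dist_norm norm_minus_commute)
    then show "norm y < 4 * R" "2 * R < norm y"
      using norm_triangle_sub[of y "(3 * R) *\<^sub>R b"] norm_triangle_sub[of "(3 * R) *\<^sub>R b" y] n
      by (auto simp: norm_minus_commute)
  qed
  have [measurable]: "A \<in> sets borel" by (simp add: A_def)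
  define m where "m = measure lborel A"
  have fin: "emeasure lborel A < \<infinity>" unfolding A_def by (rule emeasure_bounded_finite[OF bounded_ball])
  then have em: "emeasure lborel A = ennreal m" by (simp add: m_def emeasure_eq_ennreal_measure)
  have "0 < m" unfolding m_def A_def using content_ball_pos[of R "(3 * R) *\<^sub>R b"] R by simp
  define C where "C = (5 * R) powr a / m"
  have "(\<integral>\<^sup>+x. ennreal (\<bar>w x\<bar> powr p) \<partial>lborel) \<le> ennreal C * gagliardo a p w"
    if [measurable]: "w \<in> borel_measurable borel" and w0: "\<forall>x. x \<notin> \<Omega> \<longrightarrow> w x = 0" for w
  proof -
    have [measurable]: "ball 0 R \<times> A \<in> sets borel"
      by (intro borel_open open_Times) (auto simp: A_def)
    have "ennreal m * (\<integral>\<^sup>+x. ennreal (\<bar>w x\<bar> powr p) \<partial>lborel)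
        = (\<integral>\<^sup>+x. ennreal (\<bar>w x\<bar> powr p) * ennreal m \<partial>lborel)"
      by (subst nn_integral_multc) (auto simp: mult.commute)
    also have "\<dots> = (\<integral>\<^sup>+x. \<integral>\<^sup>+y. ennreal (\<bar>w x\<bar> powr p) * indicator A y \<partial>lborel \<partial>lborel)"
      by (subst nn_integral_cmult) (auto simp: em)
    also have "\<dots> \<le> (\<integral>\<^sup>+x. \<integral>\<^sup>+y. ennreal (\<bar>w x - w y\<bar> powr p) * indicator (ball 0 R \<times> A) (x, y) \<partial>lborel \<partial>lborel)"
    proof (intro nn_integral_mono)
      fix x y :: 'a
      show "ennreal (\<bar>w x\<bar> powr p) * indicator A y
          \<le> ennreal (\<bar>w x - w y\<bar> powr p) * indicator (ball 0 R \<times> A) (x, y)"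
      proof (cases "y \<in> A \<and> x \<in> \<Omega>")
        case True
        then have "w y = 0" using A_norm[of y] R w0 by force
        with True R show ?thesis by (auto simp: indicator_def)
      qed (use w0 in \<open>auto simp: indicator_def\<close>)
    qed
    also have "\<dots> \<le> ennreal ((5 * R) powr a) * gagliardo a p w"
    proof (rule nn_integral_close_pairs_le[OF a])
      fix x y :: 'a assume "(x, y) \<in> ball 0 R \<times> A"
      then show "norm (x - y) \<le> 5 * R"
        using A_norm(1)[of y] norm_triangle_ineq4[of x y] by auto
    qed measurable
    finally have "ennreal m * (\<integral>\<^sup>+x. ennreal (\<bar>w x\<bar> powr p) \<partial>lborel) \<le> ennreal ((5 * R) powr a) * gagliardo a p w" .
    then have "ennreal (1 / m) * (ennreal m * (\<integral>\<^sup>+x. ennreal (\<bar>w x\<bar> powr p) \<partial>lborel))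
        \<le> ennreal (1 / m) * (ennreal ((5 * R) powr a) * gagliardo a p w)"
      by (rule mult_left_mono) simp
    moreover have "ennreal (1 / m) * ennreal m = 1" "ennreal (1 / m) * ennreal ((5 * R) powr a) = ennreal C"
      using \<open>0 < m\<close> by (simp_all add: C_def flip: ennreal_mult')
    ultimately show ?thesis by (simp flip: mult.assoc)
  qed
  moreover have "0 \<le> C" using \<open>0 < m\<close> by (simp add: C_def)
  ultimately show ?thesis by blast
qed

text \<open>
  The half-open cubes of the lattice of mesh \<open>\<delta>\<close>, indexed by integer coordinates along the basis.
\<close>

definition cell :: "real \<Rightarrow> ('a::euclidean_space \<Rightarrow> int) \<Rightarrow> 'a set" where
  "cell \<delta> g = {y. \<forall>b\<in>Basis. \<lfloor>y \<bullet> b / \<delta>\<rfloor> = g b}"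

text \<open>
  Restricting to \<open>Basis\<close> makes the index of a cube unique, so that a bounded set meets finitely many indices.
\<close>

definition cell_index :: "real \<Rightarrow> 'a::euclidean_space \<Rightarrow> 'a \<Rightarrow> int" where
  "cell_index \<delta> x = restrict (\<lambda>b. \<lfloor>x \<bullet> b / \<delta>\<rfloor>) Basis"

lemma mem_cell_index: "x \<in> cell \<delta> (cell_index \<delta> x)"
  by (simp add: cell_def cell_index_def)

lemma cell_borel [measurable]: "cell \<delta> g \<in> sets borel"
  unfolding cell_def by measurable

lemma finite_cell_index:
  fixes \<Omega> :: "'a::euclidean_space set"
  assumes "bounded \<Omega>" "0 < \<delta>"
  shows "finite (cell_index \<delta> ` \<Omega>)"
proof -
  obtain R where R: "\<And>x. x \<in> \<Omega> \<Longrightarrow> norm x \<le> R"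
    using assms(1) by (auto simp: bounded_iff)
  have "cell_index \<delta> ` \<Omega> \<subseteq> (\<Pi>\<^sub>E b\<in>Basis. {\<lfloor>- R / \<delta>\<rfloor>..\<lfloor>R / \<delta>\<rfloor>})"
  proof (intro image_subsetI PiE_I)
    fix x b :: 'a assume "x \<in> \<Omega>" "b \<in> Basis"
    then have "\<bar>x \<bullet> b\<bar> \<le> R" using R[of x] Basis_le_norm[of b x] by simp
    then have "- R / \<delta> \<le> x \<bullet> b / \<delta>" "x \<bullet> b / \<delta> \<le> R / \<delta>"
      using assms by (intro divide_right_mono; simp)+
    then show "cell_index \<delta> x b \<in> {\<lfloor>- R / \<delta>\<rfloor>..\<lfloor>R / \<delta>\<rfloor>}"
      using \<open>b \<in> Basis\<close> unfolding cell_index_def by (simp only: restrict_apply' atLeastAtMost_iff floor_mono simp_thms)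
  qed (simp add: cell_index_def)
  then show ?thesis by (rule finite_subset) (intro finite_PiE, auto)
qed

lemma cell_diameter:
  fixes x y :: "'a::euclidean_space"
  assumes "0 < \<delta>" "x \<in> cell \<delta> g" "y \<in> cell \<delta> g"
  shows "norm (x - y) \<le> real DIM('a) * \<delta>"
proof -
  have "norm (x - y) \<le> (\<Sum>b\<in>Basis. \<bar>(x - y) \<bullet> b\<bar>)" by (rule norm_le_l1)
  also have "\<dots> \<le> (\<Sum>b::'a\<in>Basis. \<delta>)"
  proof (rule sum_mono)
    fix b :: 'a assume b: "b \<in> Basis"
    then have "\<lfloor>x \<bullet> b / \<delta>\<rfloor> = \<lfloor>y \<bullet> b / \<delta>\<rfloor>" using assms by (simp add: cell_def)
    then have "\<bar>x \<bullet> b / \<delta> - y \<bullet> b / \<delta>\<bar> \<le> 1" by linarith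
    then have "\<bar>(x \<bullet> b - y \<bullet> b) / \<delta>\<bar> \<le> 1" by (simp add: diff_divide_distrib)
    then show "\<bar>(x - y) \<bullet> b\<bar> \<le> \<delta>"
      using assms by (simp add: inner_diff_left)
  qed
  finally show ?thesis by simp
qed

lemma emeasure_cell:
  fixes g :: "'a::euclidean_space \<Rightarrow> int"
  assumes \<delta>: "0 < \<delta>"
  shows "emeasure lborel (cell \<delta> g) = ennreal (\<delta> ^ DIM('a))"
proof (rule antisym)
  define l u :: 'a where "l = (\<Sum>b\<in>Basis. (\<delta> * g b) *\<^sub>R b)" and "u = (\<Sum>b\<in>Basis. (\<delta> * (g b + 1)) *\<^sub>R b)"
  have lu: "l \<bullet> b = \<delta> * g b" "u \<bullet> b = \<delta> * (g b + 1)" if "b \<in> Basis" for b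
    using that by (simp_all add: l_def u_def)
  have diff: "(u - l) \<bullet> b = \<delta>" if "b \<in> Basis" for b
    using lu that by (simp add: inner_diff_left algebra_simps)
  have le: "l \<bullet> b \<le> u \<bullet> b" if "b \<in> Basis" for b using lu that \<delta> by simp
  have "cell \<delta> g \<subseteq> cbox l u"
  proof
    fix y assume "y \<in> cell \<delta> g"
    then have "\<lfloor>y \<bullet> b / \<delta>\<rfloor> = g b" if "b \<in> Basis" for b
      using that by (simp add: cell_def)
    then have "g b \<le> y \<bullet> b / \<delta> \<and> y \<bullet> b / \<delta> \<le> g b + 1" if "b \<in> Basis" for b
      using that floor_correct[of "y \<bullet> b / \<delta>"] by (auto simp: less_imp_le)
    then show "y \<in> cbox l u" using \<delta> lu by (auto simp: mem_box field_simps)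
  qed
  then have "emeasure lborel (cell \<delta> g) \<le> emeasure lborel (cbox l u)"
    by (intro emeasure_mono) auto
  also have "\<dots> = ennreal (\<delta> ^ DIM('a))"
    using le diff by (simp add: emeasure_lborel_cbox)
  finally show "emeasure lborel (cell \<delta> g) \<le> ennreal (\<delta> ^ DIM('a))" .
  have "box l u \<subseteq> cell \<delta> g"
  proof
    fix y assume "y \<in> box l u"
    then have "g b \<le> y \<bullet> b / \<delta> \<and> y \<bullet> b / \<delta> < g b + 1" if "b \<in> Basis" for b
      using that \<delta> lu by (auto simp: mem_box field_simps less_imp_le)
    then show "y \<in> cell \<delta> g" by (auto simp: cell_def floor_unique)
  qed
  then have "emeasure lborel (box l u) \<le> emeasure lborel (cell \<delta> g)"
    by (intro emeasure_mono) auto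
  also have "emeasure lborel (box l u) = ennreal (\<delta> ^ DIM('a))"
    using le diff by (simp add: emeasure_lborel_box)
  finally show "ennreal (\<delta> ^ DIM('a)) \<le> emeasure lborel (cell \<delta> g)" .
qed

text \<open>
  Compare \<open>t\<close> with the mean of \<open>v\<close> over \<open>Q\<close>; the difference is the mean of \<open>t - v\<close>, estimated by Jensen. With
  \<open>t = v x\<close> the first term becomes a double integral of increments after integration in \<open>x\<close>.
\<close>

lemma powr_le_mean_split:
  fixes v :: "'a::euclidean_space \<Rightarrow> real"
  assumes p: "1 < p" and [measurable]: "Q \<in> sets borel"
    and Q: "emeasure lborel Q = ennreal m" "0 < m" and v: "integrable lborel v"
  shows "ennreal (\<bar>t\<bar> powr p) \<le> ennreal (2 powr p) *
    (ennreal (1 / m) * (\<integral>\<^sup>+y. ennreal (\<bar>t - v y\<bar> powr p) * indicator Q y \<partial>lborel)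
     + ennreal (\<bar>(LINT y|lborel. indicator Q y * v y) / m\<bar> powr p))"
proof -
  let ?M = "restrict_space lborel Q"
  define c where "c = (LINT y|lborel. indicator Q y * v y) / m"
  have eM: "emeasure ?M (space ?M) = ennreal m"
    using Q by (simp add: emeasure_restrict_space space_restrict_space)
  then have mM: "m = measure ?M (space ?M)" using Q by (simp add: measure_def)
  have fin: "finite_measure ?M" by (rule finite_measureI) (unfold eM, simp)
  have vQ: "integrable ?M v"
    by (subst integrable_restrict_space) (use integrable_mult_indicator[OF _ v, of Q] in auto)
  have ti: "integrable ?M (\<lambda>y. t)" using finite_measure.integrable_const[OF fin] .
  have "(LINT y|?M. t - v y) = m * t - (LINT y|lborel. indicator Q y * v y)"
    using vQ ti mM by (simp add: integral_restrict_space)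
  then have mean: "(LINT y|?M. t - v y) / m = t - c"
    using Q by (simp add: c_def field_simps)
  have "ennreal (m * \<bar>t - c\<bar> powr p) \<le> (\<integral>\<^sup>+y. ennreal (\<bar>t - v y\<bar> powr p) \<partial>?M)"
    using Jensen_powr[OF p fin mM Q(2) Bochner_Integration.integrable_diff[OF ti vQ]] unfolding mean .
  also have "\<dots> = (\<integral>\<^sup>+y. ennreal (\<bar>t - v y\<bar> powr p) * indicator Q y \<partial>lborel)" (is "_ = ?I")
    by (rule nn_integral_restrict_space) simp
  finally have "ennreal (1 / m) * ennreal (m * \<bar>t - c\<bar> powr p) \<le> ennreal (1 / m) * ?I"
    by (rule mult_left_mono) simp
  then have J: "ennreal (\<bar>t - c\<bar> powr p) \<le> ennreal (1 / m) * ?I"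
    using Q by (simp flip: ennreal_mult')
  have "ennreal (\<bar>t\<bar> powr p) \<le> ennreal (2 powr p * (\<bar>t - c\<bar> powr p + \<bar>c\<bar> powr p))"
    using powr_add_le[of p "t - c" c] p by (intro ennreal_leI) auto
  also have "\<dots> = ennreal (2 powr p) * (ennreal (\<bar>t - c\<bar> powr p) + ennreal (\<bar>c\<bar> powr p))"
    by (simp add: ennreal_mult')
  also have "\<dots> \<le> ennreal (2 powr p) * (ennreal (1 / m) * ?I + ennreal (\<bar>c\<bar> powr p))"
    by (intro mult_left_mono add_right_mono J) auto
  finally show ?thesis unfolding c_def .
qed

section \<open>Compactness in Lp\<close>

text \<open>
  The quantitative form of compactness. As the volume of a cube is \<open>\<delta> ^ DIM('a)\<close>, the coefficient of the seminorm
  is of order \<open>\<delta> powr (a - DIM('a))\<close> and becomes small with \<open>\<delta>\<close> when \<open>a > DIM('a)\<close>, while the second term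
  depends on finitely many linear functionals of \<open>v\<close> only.
\<close>

lemma Lp_le_gagliardo_plus_means:
  fixes v :: "'a::euclidean_space \<Rightarrow> real" and \<delta> :: real
  assumes p: "1 < p" and a: "0 \<le> a" and \<delta>: "0 < \<delta>"
    and [measurable]: "\<Omega> \<in> sets borel" and vi: "integrable lborel v"
    and v0: "\<And>x. x \<notin> \<Omega> \<Longrightarrow> v x = 0"
    and G: "finite G" "cell_index \<delta> ` \<Omega> \<subseteq> G"
  shows "(\<integral>\<^sup>+x. ennreal (\<bar>v x\<bar> powr p) \<partial>lborel) \<le> ennreal (2 powr p) *
    (ennreal (1 / \<delta> ^ DIM('a) * (real DIM('a) * \<delta>) powr a) * gagliardo a p v
     + ennreal (\<Sum>g\<in>G. \<bar>(LINT y|lborel. indicator (cell \<delta> g) y * v y) / \<delta> ^ DIM('a)\<bar> powr p)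
       * emeasure lborel \<Omega>)"
proof -
  have [measurable]: "v \<in> borel_measurable borel" using vi by simp
  define m where "m = \<delta> ^ DIM('a)"
  have m: "0 < m" using \<delta> by (simp add: m_def)
  define S where "S = {z::'a\<times>'a. \<forall>b\<in>Basis. \<lfloor>fst z \<bullet> b / \<delta>\<rfloor> = \<lfloor>snd z \<bullet> b / \<delta>\<rfloor>}"
  have S_iff: "(x, y) \<in> S \<longleftrightarrow> y \<in> cell \<delta> (cell_index \<delta> x)" for x y
    by (auto simp: S_def cell_def cell_index_def)
  have fl: "(\<lambda>z::'a\<times>'a. real_of_int \<lfloor>fst z \<bullet> b / \<delta>\<rfloor>) \<in> borel_measurable (borel \<Otimes>\<^sub>M borel)"
    "(\<lambda>z::'a\<times>'a. real_of_int \<lfloor>snd z \<bullet> b / \<delta>\<rfloor>) \<in> borel_measurable (borel \<Otimes>\<^sub>M borel)" for b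
    by measurable
  have "{z \<in> space (borel \<Otimes>\<^sub>M borel). \<forall>b\<in>Basis. real_of_int \<lfloor>fst z \<bullet> b / \<delta>\<rfloor> = real_of_int \<lfloor>snd z \<bullet> b / \<delta>\<rfloor>}
      \<in> sets ((borel \<Otimes>\<^sub>M borel) :: ('a \<times> 'a) measure)"
    by (intro sets.sets_Collect_finite_All borel_measurable_eq fl) auto
  then have S2 [measurable]: "S \<in> sets (borel \<Otimes>\<^sub>M borel)"
    by (simp add: S_def space_pair_measure)
  then have S [measurable]: "S \<in> sets borel" by (simp only: borel_prod)
  define mean where "mean g = \<bar>(LINT y|lborel. indicator (cell \<delta> g) y * v y) / m\<bar> powr p" for g
  define I where "I x = (\<integral>\<^sup>+y. ennreal (\<bar>v x - v y\<bar> powr p) * indicator S (x, y) \<partial>lborel)" for x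
  have I [measurable]: "I \<in> borel_measurable borel"
  proof -
    have "(\<lambda>(x, y). ennreal (\<bar>v x - v y\<bar> powr p) * indicator S (x, y)) \<in> borel_measurable (borel \<Otimes>\<^sub>M lborel)"
    proof -
      have [measurable]: "S \<in> sets (borel \<Otimes>\<^sub>M lborel)"
        using S2 sets_pair_measure_cong[of "borel::'a measure" borel "lborel::'a measure" borel] by simp
      show ?thesis by measurable
    qed
    then show ?thesis unfolding I_def by (rule lborel.borel_measurable_nn_integral)
  qed
  have point: "ennreal (\<bar>v x\<bar> powr p) \<le> ennreal (2 powr p) *
      (ennreal (1 / m) * I x + ennreal (\<Sum>g\<in>G. mean g) * indicator \<Omega> x)" for x
  proof (cases "x \<in> \<Omega>")
    case True
    let ?Q = "cell \<delta> (cell_index \<delta> x)"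
    have "ennreal (\<bar>v x\<bar> powr p) \<le> ennreal (2 powr p) *
        (ennreal (1 / m) * (\<integral>\<^sup>+y. ennreal (\<bar>v x - v y\<bar> powr p) * indicator ?Q y \<partial>lborel)
          + ennreal (mean (cell_index \<delta> x)))"
      unfolding mean_def
      by (rule powr_le_mean_split[OF p _ _ m vi]) (simp_all add: emeasure_cell \<delta> m_def)
    also have "(\<integral>\<^sup>+y. ennreal (\<bar>v x - v y\<bar> powr p) * indicator ?Q y \<partial>lborel) = I x"
      unfolding I_def by (intro nn_integral_cong) (simp add: indicator_def S_iff)
    also have "mean (cell_index \<delta> x) \<le> (\<Sum>g\<in>G. mean g)"
      using G True by (intro member_le_sum) (auto simp: mean_def)
    finally show ?thesis
      using True by (simp add: ennreal_leI add_left_mono mult_left_mono)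
  qed (use v0 in auto)
  have "(\<integral>\<^sup>+x. ennreal (\<bar>v x\<bar> powr p) \<partial>lborel) \<le> (\<integral>\<^sup>+x. ennreal (2 powr p) *
      (ennreal (1 / m) * I x + ennreal (\<Sum>g\<in>G. mean g) * indicator \<Omega> x) \<partial>lborel)"
    by (intro nn_integral_mono point)
  also have "\<dots> = ennreal (2 powr p) *
      (ennreal (1 / m) * (\<integral>\<^sup>+x. I x \<partial>lborel) + ennreal (\<Sum>g\<in>G. mean g) * emeasure lborel \<Omega>)"
    by (simp add: nn_integral_cmult nn_integral_add nn_integral_cmult_indicator)
  also have "(\<integral>\<^sup>+x. I x \<partial>lborel) \<le> ennreal ((real DIM('a) * \<delta>) powr a) * gagliardo a p v"
    unfolding I_def
  proof (rule nn_integral_close_pairs_le[OF a])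
    fix x y :: 'a assume "(x, y) \<in> S"
    then show "norm (x - y) \<le> real DIM('a) * \<delta>"
      using cell_diameter[OF \<delta> mem_cell_index] by (simp add: S_iff)
  qed measurable
  finally have le: "(\<integral>\<^sup>+x. ennreal (\<bar>v x\<bar> powr p) \<partial>lborel) \<le> ennreal (2 powr p) * (ennreal (1 / m) *
      (ennreal ((real DIM('a) * \<delta>) powr a) * gagliardo a p v) + ennreal (\<Sum>g\<in>G. mean g) * emeasure lborel \<Omega>)"
    by (simp add: add_right_mono mult_left_mono)
  have "ennreal (1 / m * (real DIM('a) * \<delta>) powr a) = ennreal (1 / m) * ennreal ((real DIM('a) * \<delta>) powr a)"
    by (rule ennreal_mult') (use m in simp)
  with le show ?thesis
    unfolding m_def[symmetric] mean_def by (simp only: mult.assoc)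
qed

lemma gagliardo_diff_le:
  fixes v w :: "'a::euclidean_space \<Rightarrow> real"
  assumes p: "0 \<le> p" and [measurable]: "v \<in> borel_measurable borel" "w \<in> borel_measurable borel"
  shows "gagliardo a p (\<lambda>x. v x - w x) \<le> ennreal (2 powr p) * (gagliardo a p v + gagliardo a p w)"
proof -
  have m: "(\<lambda>z::'a\<times>'a. ennreal (\<bar>f (fst z) - f (snd z)\<bar> powr p / norm (fst z - snd z) powr a))
      \<in> borel_measurable borel" if [measurable]: "f \<in> borel_measurable borel" for f
    unfolding borel_prod[symmetric] by measurable
  have "gagliardo a p (\<lambda>x. v x - w x) \<le> (\<integral>\<^sup>+z. ennreal (2 powr p) *
      (ennreal (\<bar>v (fst z) - v (snd z)\<bar> powr p / norm (fst z - snd z) powr a)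
       + ennreal (\<bar>w (fst z) - w (snd z)\<bar> powr p / norm (fst z - snd z) powr a)) \<partial>lborel)"
    unfolding gagliardo_def case_prod_unfold
  proof (rule nn_integral_mono)
    fix z :: "'a \<times> 'a"
    have "\<bar>v (fst z) - w (fst z) - (v (snd z) - w (snd z))\<bar> powr p
        \<le> 2 powr p * (\<bar>v (fst z) - v (snd z)\<bar> powr p + \<bar>w (fst z) - w (snd z)\<bar> powr p)"
      using powr_diff_le[OF p, of "v (fst z) - v (snd z)" "w (fst z) - w (snd z)"]
      by (simp add: algebra_simps)
    from divide_right_mono[OF this, of "norm (fst z - snd z) powr a"]
    have "\<bar>v (fst z) - w (fst z) - (v (snd z) - w (snd z))\<bar> powr p / norm (fst z - snd z) powr a
        \<le> 2 powr p * (\<bar>v (fst z) - v (snd z)\<bar> powr p / norm (fst z - snd z) powr a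
          + \<bar>w (fst z) - w (snd z)\<bar> powr p / norm (fst z - snd z) powr a)"
      by (simp add: add_divide_distrib distrib_left)
    then show "ennreal (\<bar>v (fst z) - w (fst z) - (v (snd z) - w (snd z))\<bar> powr p / norm (fst z - snd z) powr a)
        \<le> ennreal (2 powr p) *
      (ennreal (\<bar>v (fst z) - v (snd z)\<bar> powr p / norm (fst z - snd z) powr a)
       + ennreal (\<bar>w (fst z) - w (snd z)\<bar> powr p / norm (fst z - snd z) powr a))"
      by (simp add: ennreal_leI flip: ennreal_mult' ennreal_plus)
  qed
  also have "\<dots> = ennreal (2 powr p) * (gagliardo a p v + gagliardo a p w)"
    unfolding gagliardo_def case_prod_unfold using m by (simp add: nn_integral_cmult nn_integral_add)
  finally show ?thesis .
qed

text \<open>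
  A fractional Rellich theorem. The integrals over the countably many cubes of mesh \<open>1/(n+1)\<close> that meet
  \<open>\<Omega>\<close> are bounded, so a diagonal subsequence makes all of them converge. Applied to differences of its members,
  the preceding estimate shows that this subsequence is Cauchy in \<open>L\<^sup>p\<close>.
\<close>

theorem gagliardo_compact:
  fixes w :: "nat \<Rightarrow> 'a::euclidean_space \<Rightarrow> real"
  assumes p: "1 < p" and a: "real DIM('a) < a"
    and \<Omega> [measurable]: "\<Omega> \<in> sets borel" and bdd: "bounded \<Omega>"
    and w [measurable]: "\<And>j. w j \<in> borel_measurable borel"
    and w0: "\<And>j x. x \<notin> \<Omega> \<Longrightarrow> w j x = 0"
    and B: "\<And>j. gagliardo a p (w j) \<le> ennreal B"
  shows "\<exists>r v. strict_mono (r::nat \<Rightarrow> nat) \<and> v \<in> borel_measurable lborel \<and>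
      (AE x in lborel. (\<lambda>j. w (r j) x) \<longlonglongrightarrow> v x) \<and>
      (\<lambda>j. \<integral>\<^sup>+x. ennreal (\<bar>w (r j) x - v x\<bar> powr p) \<partial>lborel) \<longlonglongrightarrow> 0"
proof -
  have a0: "0 \<le> a" using a by linarith
  define V where "V = measure lborel \<Omega>"
  have eV: "emeasure lborel \<Omega> = ennreal V"
    unfolding V_def using emeasure_bounded_finite[OF bdd] by (intro emeasure_eq_ennreal_measure) auto
  have V: "0 \<le> V" by (simp add: V_def)
  obtain C where C: "0 \<le> C" "\<And>j. (\<integral>\<^sup>+x. ennreal (\<bar>w j x\<bar> powr p) \<partial>lborel) \<le> ennreal C * gagliardo a p (w j)"
    using Poincare_gagliardo[OF bdd a0, of p] w w0 by meson
  have Lp: "(\<integral>\<^sup>+x. ennreal (\<bar>w j x\<bar> powr p) \<partial>lborel) \<le> ennreal (C * B)" for j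
    using order_trans[OF C(2)[of j] mult_left_mono[OF B[of j], of "ennreal C"]] C(1)
    by (simp add: ennreal_mult')
  define A where "A = V + max 0 (C * B)"
  have A0: "0 \<le> A" using V by (simp add: A_def)
  have L1: "(\<integral>\<^sup>+x. ennreal (norm (w j x)) \<partial>lborel) \<le> ennreal A" for j
  proof -
    have le: "ennreal (norm (w j x)) \<le> indicator \<Omega> x + ennreal (\<bar>w j x\<bar> powr p)" for x
    proof (cases "x \<in> \<Omega>")
      case True
      \<comment> \<open>Bounds in \<open>L\<^sup>1\<close> on a set of finite measure follow from those in \<open>L\<^sup>p\<close>.\<close>
      have "\<bar>w j x\<bar> \<le> 1 + \<bar>w j x\<bar> powr p"
      proof (cases "\<bar>w j x\<bar> \<le> 1")
        case False
        then have "\<bar>w j x\<bar> powr 1 \<le> \<bar>w j x\<bar> powr p" using p by (intro powr_mono) auto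
        then show ?thesis by simp
      qed (simp add: add_increasing2)
      then have "ennreal \<bar>w j x\<bar> \<le> ennreal (1 + \<bar>w j x\<bar> powr p)" by (rule ennreal_leI)
      then show ?thesis using True by simp
    qed (use w0 in simp)
    have "(\<integral>\<^sup>+x. ennreal (norm (w j x)) \<partial>lborel) \<le> (\<integral>\<^sup>+x. indicator \<Omega> x + ennreal (\<bar>w j x\<bar> powr p) \<partial>lborel)"
      by (intro nn_integral_mono le)
    also have "\<dots> = ennreal V + (\<integral>\<^sup>+x. ennreal (\<bar>w j x\<bar> powr p) \<partial>lborel)"
      by (simp add: nn_integral_add eV)
    also have "\<dots> \<le> ennreal V + ennreal (max 0 (C * B))"
      by (intro add_left_mono order_trans[OF Lp] ennreal_leI) simp
    finally show ?thesis using V by (simp add: A_def)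
  qed
  have wi: "integrable lborel (w j)" for j
    using L1[of j] by (intro integrableI_bounded) (auto intro: le_less_trans)
  define \<delta> where "\<delta> n = 1 / real (Suc n)" for n
  have \<delta>: "0 < \<delta> n" for n by (simp add: \<delta>_def)
  define G where "G n = cell_index (\<delta> n) ` \<Omega>" for n
  have G: "finite (G n)" for n unfolding G_def by (rule finite_cell_index[OF bdd \<delta>])
  \<comment> \<open>The integrals over all cubes of all meshes as one family indexed by pairs, for the diagonal argument.\<close>
  define c where "c j = (\<lambda>(n, g). LINT y|lborel. indicator (cell (\<delta> n) g) y * w j y)" for j
  have ci: "integrable lborel (\<lambda>y. indicator (cell (\<delta> n) g) y * w j y)" for n g j
    using integrable_mult_indicator[OF _ wi, of "cell (\<delta> n) g" j] by simp
  have c_le: "norm (c j z) \<le> A" for j z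
  proof -
    obtain n g where z: "z = (n, g)" by (cases z)
    have "norm (c j z) \<le> (LINT y|lborel. norm (indicator (cell (\<delta> n) g) y * w j y))"
      unfolding c_def z prod.case by (rule integral_norm_bound)
    also have "\<dots> \<le> (LINT y|lborel. norm (w j y))"
      using ci wi by (intro integral_mono integrable_norm) (auto simp: indicator_def)
    also have "\<dots> \<le> A"
      using L1[of j] A0
      by (subst (asm) nn_integral_eq_integral[OF integrable_norm[OF wi]]) auto
    finally show ?thesis .
  qed
  have "countable (SIGMA n:UNIV. G n)"
    using G by (intro countable_SIGMA) (auto intro: countable_finite)
  from function_convergent_subsequence[OF this, of c A] c_le
  obtain r where r: "strict_mono (r::nat \<Rightarrow> nat)"
    and conv: "\<And>z. z \<in> (SIGMA n:UNIV. G n) \<Longrightarrow> \<exists>l. (\<lambda>j. c (r j) z) \<longlonglongrightarrow> l"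
    by blast
  have gd: "gagliardo a p (\<lambda>x. w i x - w j x) \<le> ennreal (2 powr p * (2 * max 0 B))" for i j
  proof -
    have "gagliardo a p (\<lambda>x. w i x - w j x) \<le> ennreal (2 powr p) * (gagliardo a p (w i) + gagliardo a p (w j))"
      using p by (intro gagliardo_diff_le w) auto
    also have "\<dots> \<le> ennreal (2 powr p) * (ennreal (max 0 B) + ennreal (max 0 B))"
      by (intro mult_left_mono add_mono order_trans[OF B] ennreal_leI) auto
    also have "\<dots> = ennreal (2 powr p * (2 * max 0 B))"
      by (simp flip: ennreal_mult' ennreal_plus)
    finally show ?thesis .
  qed
  define K where "K n = 1 / \<delta> n ^ DIM('a) * (real DIM('a) * \<delta> n) powr a" for n
  define D where "D n i j = (\<Sum>g\<in>G n. \<bar>(c i (n, g) - c j (n, g)) / \<delta> n ^ DIM('a)\<bar> powr p)" for n i j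
  have est: "(\<integral>\<^sup>+x. ennreal (\<bar>w i x - w j x\<bar> powr p) \<partial>lborel)
      \<le> ennreal (2 powr p * (K n * (2 powr p * (2 * max 0 B)) + D n i j * V))" for n i j
  proof -
    have K0: "0 \<le> K n" using \<delta>[of n] by (simp add: K_def)
    have D0: "0 \<le> D n i j" by (simp add: D_def sum_nonneg)
    have "(\<integral>\<^sup>+x. ennreal (\<bar>w i x - w j x\<bar> powr p) \<partial>lborel) \<le> ennreal (2 powr p) *
      (ennreal (K n) * gagliardo a p (\<lambda>x. w i x - w j x)
       + ennreal (\<Sum>g\<in>G n. \<bar>(LINT y|lborel. indicator (cell (\<delta> n) g) y * (w i y - w j y)) / \<delta> n ^ DIM('a)\<bar> powr p)
       * ennreal V)"
      unfolding K_def eV[symmetric]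
      by (rule Lp_le_gagliardo_plus_means[OF p a0 \<delta> \<Omega> _ _ G])
        (use wi w0 in \<open>auto simp: G_def\<close>)
    also have "(\<Sum>g\<in>G n. \<bar>(LINT y|lborel. indicator (cell (\<delta> n) g) y * (w i y - w j y)) / \<delta> n ^ DIM('a)\<bar> powr p) = D n i j"
      unfolding D_def c_def prod.case
      by (simp add: right_diff_distrib Bochner_Integration.integral_diff[OF ci ci])
    also have "ennreal (2 powr p) * (ennreal (K n) * gagliardo a p (\<lambda>x. w i x - w j x) + ennreal (D n i j) * ennreal V)
        \<le> ennreal (2 powr p) * (ennreal (K n) * ennreal (2 powr p * (2 * max 0 B)) + ennreal (D n i j) * ennreal V)"
      by (intro mult_left_mono add_right_mono gd) auto
    also have "\<dots> = ennreal (2 powr p * (K n * (2 powr p * (2 * max 0 B)) + D n i j * V))"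
      using K0 D0 V by (simp flip: ennreal_mult ennreal_plus)
    finally show ?thesis .
  qed
  have K_lim: "K \<longlonglongrightarrow> 0"
  proof -
    have "K n = real DIM('a) powr a * \<delta> n powr (a - real DIM('a))" for n
      using \<delta>[of n] by (simp add: K_def powr_mult powr_diff powr_realpow)
    moreover have "(\<lambda>n. \<delta> n powr (a - real DIM('a))) \<longlonglongrightarrow> 0"
    proof (rule tendsto_zero_powrI[where b="a - real DIM('a)"])
      show "\<delta> \<longlonglongrightarrow> 0" unfolding \<delta>_def by (rule LIMSEQ_inverse_real_of_nat[unfolded inverse_eq_divide])
    qed (use a \<delta> in \<open>auto simp: less_imp_le\<close>)
    ultimately show ?thesis using tendsto_mult_right_zero[of "\<lambda>n. \<delta> n powr (a - real DIM('a))" sequentially] by presburger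
  qed
  have "\<exists>N. \<forall>i\<ge>N. \<forall>j\<ge>N. (\<integral>\<^sup>+x. ennreal (\<bar>w (r i) x - w (r j) x\<bar> powr p) \<partial>lborel) \<le> ennreal e"
    if e: "0 < e" for e
  proof -
    have "(\<lambda>n. 2 powr p * (K n * (2 powr p * (2 * max 0 B)))) \<longlonglongrightarrow> 2 powr p * (0 * (2 powr p * (2 * max 0 B)))"
      by (intro tendsto_intros K_lim)
    then have "(\<lambda>n. 2 powr p * (K n * (2 powr p * (2 * max 0 B)))) \<longlonglongrightarrow> 0" by simp
    then have "\<forall>\<^sub>F n in sequentially. 2 powr p * (K n * (2 powr p * (2 * max 0 B))) < e / 2"
      by (rule order_tendstoD(2)) (use e in simp)
    then obtain n where n: "2 powr p * (K n * (2 powr p * (2 * max 0 B))) < e / 2"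
      using eventually_happens'[OF sequentially_bot] by blast
    have "\<exists>l. (\<lambda>j. c (r j) (n, g)) \<longlonglongrightarrow> l" if "g \<in> G n" for g
      using conv[of "(n, g)"] that by simp
    then obtain l where l: "\<And>g. g \<in> G n \<Longrightarrow> (\<lambda>j. c (r j) (n, g)) \<longlonglongrightarrow> l g" by metis
    have "((\<lambda>(i, j). 2 powr p * (D n (r i) (r j) * V)) \<longlongrightarrow>
        2 powr p * ((\<Sum>g\<in>G n. \<bar>(l g - l g) / \<delta> n ^ DIM('a)\<bar> powr p) * V)) (sequentially \<times>\<^sub>F sequentially)"
      unfolding D_def case_prod_unfold
    proof (intro tendsto_intros tendsto_sum tendsto_powr')
      fix g assume "g \<in> G n"
      from l[OF this] show "((\<lambda>z. c (r (fst z)) (n, g)) \<longlongrightarrow> l g) (sequentially \<times>\<^sub>F sequentially)"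
        "((\<lambda>z. c (r (snd z)) (n, g)) \<longlongrightarrow> l g) (sequentially \<times>\<^sub>F sequentially)"
        by (auto intro: filterlim_compose[OF _ filterlim_fst] filterlim_compose[OF _ filterlim_snd])
    qed (use p \<delta>[of n] in auto)
    then have "((\<lambda>(i, j). 2 powr p * (D n (r i) (r j) * V)) \<longlongrightarrow> 0) (sequentially \<times>\<^sub>F sequentially)"
      using p by simp
    then have "\<forall>\<^sub>F z in sequentially \<times>\<^sub>F sequentially. (\<lambda>(i, j). 2 powr p * (D n (r i) (r j) * V)) z < e / 2"
      by (rule order_tendstoD(2)) (use e in simp)
    then obtain N where N: "\<And>i j. i \<ge> N \<Longrightarrow> j \<ge> N \<Longrightarrow> 2 powr p * (D n (r i) (r j) * V) < e / 2"
      by (auto simp: eventually_prod_sequentially)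
    show ?thesis
    proof (intro exI allI impI)
      fix i j assume "N \<le> i" "N \<le> j"
      show "(\<integral>\<^sup>+x. ennreal (\<bar>w (r i) x - w (r j) x\<bar> powr p) \<partial>lborel) \<le> ennreal e"
        by (rule order_trans[OF est[of "r i" "r j" n]])
          (use n N[OF \<open>N \<le> i\<close> \<open>N \<le> j\<close>] in \<open>auto intro!: ennreal_leI simp: distrib_left\<close>)
    qed
  qed
  from Lp_Cauchy_convergent_subsequence[of p "\<lambda>j. w (r j)" lborel, OF _ _ this] p
  obtain r' v where "strict_mono (r'::nat \<Rightarrow> nat)" "v \<in> borel_measurable lborel"
      "AE x in lborel. (\<lambda>j. w (r (r' j)) x) \<longlonglongrightarrow> v x"
      "(\<lambda>j. \<integral>\<^sup>+x. ennreal (\<bar>w (r (r' j)) x - v x\<bar> powr p) \<partial>lborel) \<longlonglongrightarrow> 0"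
    by auto
  then show ?thesis
    using strict_mono_o[OF r, of r'] by (intro exI[of _ "r \<circ> r'"] exI[of _ v]) auto
qed

section \<open>Increments as functions in a weighted Lp space\<close>

text \<open>
  Elements of \<open>X\<^sub>0\<close> are only Lebesgue measurable, and a Borel map composes well with such functions only if
  preimages of null sets are null. This is needed for both projections and for the difference
  \<open>(x, y) \<mapsto> x - y\<close>, through which the kernel factors.
\<close>

lemma measurable_lebesgue_pullback:
  fixes T :: "'b::euclidean_space \<Rightarrow> 'a::euclidean_space"
  assumes [measurable]: "T \<in> borel_measurable borel"
    and null: "\<And>N. N \<in> null_sets lborel \<Longrightarrow> T -` N \<in> null_sets lborel"
  shows "T \<in> lebesgue \<rightarrow>\<^sub>M lebesgue"
proof (rule completion.measurable_completion2)
  show *: "T \<in> lebesgue \<rightarrow>\<^sub>M lborel" by (rule measurable_completion) simp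
  show "null_sets lborel \<subseteq> null_sets (distr lebesgue lborel T)"
  proof
    fix N :: "'a set" assume "N \<in> null_sets lborel"
    with null[OF this] * show "N \<in> null_sets (distr lebesgue lborel T)"
      by (auto simp: null_sets_def emeasure_distr)
  qed
qed

lemma AE_lebesgue_pullback:
  fixes T :: "'b::euclidean_space \<Rightarrow> 'a::euclidean_space"
  assumes "\<And>N. N \<in> null_sets lborel \<Longrightarrow> T -` N \<in> null_sets lborel"
    and "AE x in lborel. P x"
  shows "AE z in lborel. P (T z)"
proof -
  from assms(2) obtain N where N: "{x. \<not> P x} \<subseteq> N" "N \<in> null_sets lborel"
    by (auto simp: eventually_ae_filter)
  show ?thesis
    by (rule AE_I'[OF assms(1)[OF N(2)]]) (use N in auto)
qed

lemma null_sets_pullback_fst: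
  assumes "N \<in> null_sets (lborel :: 'a::euclidean_space measure)"
  shows "fst -` N \<in> null_sets (lborel :: ('a \<times> 'b::euclidean_space) measure)"
proof -
  have [measurable]: "N \<in> sets borel" using assms by auto
  have "fst -` N = N \<times> (UNIV :: 'b set)" by auto
  then have "emeasure (lborel \<Otimes>\<^sub>M lborel) (fst -` N :: ('a \<times> 'b) set) = 0"
    using assms by (simp add: lborel.emeasure_pair_measure_Times null_setsD1)
  moreover have "(fst -` N :: ('a \<times> 'b) set) \<in> sets borel"
    using measurable_sets_borel[OF borel_measurable_continuous_onI[OF continuous_on_fst[OF continuous_on_id]], of N] by simp
  ultimately show ?thesis by (simp add: null_sets_def lborel_prod)
qed

lemma null_sets_pullback_snd:
  assumes "N \<in> null_sets (lborel :: 'a::euclidean_space measure)"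
  shows "snd -` N \<in> null_sets (lborel :: ('b::euclidean_space \<times> 'a) measure)"
proof -
  have [measurable]: "N \<in> sets borel" using assms by auto
  have "snd -` N = (UNIV :: 'b set) \<times> N" by auto
  then have "emeasure (lborel \<Otimes>\<^sub>M lborel) (snd -` N :: ('b \<times> 'a) set) = 0"
    using assms by (simp add: lborel.emeasure_pair_measure_Times null_setsD1)
  moreover have "(snd -` N :: ('b \<times> 'a) set) \<in> sets borel"
    using measurable_sets_borel[OF borel_measurable_continuous_onI[OF continuous_on_snd[OF continuous_on_id]], of N] by simp
  ultimately show ?thesis by (simp add: null_sets_def lborel_prod)
qed

text \<open>
  By Tonelli, as every section of the preimage is a translate of \<open>N\<close>.
\<close>

lemma null_sets_pullback_diff:
  assumes N: "N \<in> null_sets (lborel :: 'a::euclidean_space measure)"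
  shows "(\<lambda>z. fst z - snd z) -` N \<in> null_sets (lborel :: ('a \<times> 'a) measure)"
proof -
  let ?A = "(\<lambda>z. fst z - snd z) -` N :: ('a \<times> 'a) set"
  have [measurable]: "N \<in> sets borel" using N by auto
  have A: "?A \<in> sets borel"
    by (rule measurable_sets_borel[OF borel_measurable_continuous_onI]) (auto intro!: continuous_intros)
  then have "emeasure (lborel \<Otimes>\<^sub>M lborel) ?A = (\<integral>\<^sup>+y. emeasure lborel ((\<lambda>x. (x, y)) -` ?A) \<partial>lborel)"
    by (intro lborel_pair.emeasure_pair_measure_alt2) (simp only: lborel_prod sets_lborel)
  also have "\<dots> = 0"
    using null_setsD1[OF null_sets_translation[OF N]] by (simp add: vimage_def)
  finally show ?thesis using A by (simp add: null_sets_def lborel_prod)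
qed

lemma AE_fst_snd:
  assumes "AE x in lborel. P (x::'a::euclidean_space)"
  shows "AE z in lborel. P (fst z) \<and> P (snd (z::'a \<times> 'a))"
  by (rule eventually_conj)
    (rule AE_lebesgue_pullback[OF null_sets_pullback_fst assms]
      AE_lebesgue_pullback[OF null_sets_pullback_snd assms]; assumption)+

lemma AE_off_diagonal: "AE z in lborel. fst z \<noteq> snd (z::'a::euclidean_space \<times> 'a)"
  using AE_lebesgue_pullback[OF null_sets_pullback_diff, of "\<lambda>x. x \<noteq> 0"] AE_lborel_singleton[of "0::'a"]
  by simp

definition increment :: "('a::euclidean_space \<Rightarrow> real) \<Rightarrow> 'a \<times> 'a \<Rightarrow> real" where
  "increment w z = w (fst z) - w (snd z)"

text \<open>
  Division by \<open>0 powr p = 0\<close> makes the weight vanish on the diagonal, whatever the value of \<open>k\<close> at \<open>0\<close>.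
\<close>

definition pair_weight :: "real \<Rightarrow> (real \<Rightarrow> real) \<Rightarrow> 'a::euclidean_space \<times> 'a \<Rightarrow> real" where
  "pair_weight p k z = k (norm (fst z - snd z)) / norm (fst z - snd z) powr p"

definition kernel_measure :: "real \<Rightarrow> (real \<Rightarrow> real) \<Rightarrow> ('a::euclidean_space \<times> 'a) measure" where
  "kernel_measure p k = density lebesgue (\<lambda>z. ennreal (pair_weight p k z))"

lemma measurable_kernel_measure [simp]:
  "borel_measurable (kernel_measure p k) = borel_measurable lebesgue"
  by (intro measurable_cong_sets) (simp_all add: kernel_measure_def)

lemma measurable_increment:
  fixes w :: "'a::euclidean_space \<Rightarrow> real"
  assumes "w \<in> borel_measurable lebesgue"
  shows "increment w \<in> borel_measurable lebesgue"
proof -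
  have "fst \<in> (lebesgue :: ('a \<times> 'a) measure) \<rightarrow>\<^sub>M lebesgue"
    by (rule measurable_lebesgue_pullback[OF _ null_sets_pullback_fst])
      (simp_all add: borel_measurable_continuous_onI continuous_on_fst)
  moreover have "snd \<in> (lebesgue :: ('a \<times> 'a) measure) \<rightarrow>\<^sub>M lebesgue"
    by (rule measurable_lebesgue_pullback[OF _ null_sets_pullback_snd])
      (simp_all add: borel_measurable_continuous_onI continuous_on_snd)
  ultimately have "(\<lambda>z. w (fst z)) \<in> borel_measurable (lebesgue :: ('a \<times> 'a) measure)"
    "(\<lambda>z. w (snd z)) \<in> borel_measurable (lebesgue :: ('a \<times> 'a) measure)"
    using assms by (auto intro: measurable_compose)
  then show ?thesis unfolding increment_def[abs_def] by (rule borel_measurable_diff)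
qed

text \<open>
  Integrability on balls makes each truncation of \<open>k(|z|)\<close> to a ball measurable; the kernel is their limit.
\<close>

lemma measurable_pair_weight:
  assumes "admissible_kernel TYPE('a::euclidean_space) p s c0 k"
  shows "pair_weight p k \<in> borel_measurable (lebesgue :: ('a \<times> 'a) measure)"
proof -
  have kn: "(\<lambda>z::'a. k (norm z)) \<in> borel_measurable lebesgue"
  proof (rule borel_measurable_LIMSEQ_real)
    fix z :: 'a
    obtain n0 :: nat where "norm z < real n0" using reals_Archimedean2 by blast
    then have "\<forall>\<^sub>F n in sequentially. indicator (ball 0 (real (Suc n))) z *\<^sub>R k (norm z) = k (norm z)"
      by (intro eventually_sequentiallyI[of n0]) (auto simp: indicator_def)
    then show "(\<lambda>n. indicator (ball 0 (real (Suc n))) z *\<^sub>R k (norm z)) \<longlonglongrightarrow> k (norm z)"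
      by (rule tendsto_eventually)
  next
    fix n :: nat
    have "set_integrable lebesgue (ball (0::'a) (real (Suc n))) (\<lambda>z. k (norm z))"
      using assms unfolding admissible_kernel_def by (metis of_nat_0_less_iff zero_less_Suc)
    then show "(\<lambda>z::'a. indicator (ball 0 (real (Suc n))) z *\<^sub>R k (norm z)) \<in> borel_measurable lebesgue"
      unfolding set_integrable_def by (rule borel_measurable_integrable)
  qed
  have "(\<lambda>z. fst z - snd z) \<in> (lebesgue :: ('a \<times> 'a) measure) \<rightarrow>\<^sub>M lebesgue"
    by (rule measurable_lebesgue_pullback[OF _ null_sets_pullback_diff])
      (auto intro!: borel_measurable_continuous_onI continuous_intros)
  then have "(\<lambda>z. k (norm (fst z - snd z))) \<in> borel_measurable (lebesgue :: ('a \<times> 'a) measure)"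
    using kn by (rule measurable_compose)
  moreover have "(\<lambda>z. norm (fst z - snd z) powr p) \<in> borel_measurable (lebesgue :: ('a \<times> 'a) measure)"
  proof (rule measurable_completion)
    have [measurable]: "(\<lambda>z::'a\<times>'a. norm (fst z - snd z)) \<in> borel_measurable lborel"
      by (auto intro!: borel_measurable_continuous_onI continuous_intros)
    show "(\<lambda>z::'a\<times>'a. norm (fst z - snd z) powr p) \<in> borel_measurable lborel"
      by measurable
  qed
  ultimately show ?thesis unfolding pair_weight_def[abs_def] by (rule borel_measurable_divide)
qed

lemma pair_weight_pos:
  fixes z :: "'a::euclidean_space \<times> 'a"
  assumes "admissible_kernel TYPE('a) p s c0 k" "fst z \<noteq> snd z"
  shows "0 < pair_weight p k z"
proof -
  have "\<forall>y::'a. y \<noteq> 0 \<longrightarrow> 0 < k (norm y)"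
    using assms(1) unfolding admissible_kernel_def by blast
  from this[rule_format, of "fst z - snd z"] assms(2) show ?thesis
    unfolding pair_weight_def by (intro divide_pos_pos) auto
qed

lemma pair_weight_nonneg:
  fixes z :: "'a::euclidean_space \<times> 'a"
  assumes "admissible_kernel TYPE('a) p s c0 k"
  shows "0 \<le> pair_weight p k z"
proof (cases "fst z = snd z")
  case True then show ?thesis by (simp add: pair_weight_def)
qed (use pair_weight_pos[OF assms] in \<open>auto simp: less_imp_le\<close>)

text \<open>
  The weight is positive off the diagonal, which is a null set.
\<close>

lemma AE_kernel_measure_iff:
  fixes P :: "'a::euclidean_space \<times> 'a \<Rightarrow> bool"
  assumes "admissible_kernel TYPE('a) p s c0 k"
  shows "(AE z in kernel_measure p k. P z) \<longleftrightarrow> (AE z in lborel. P z)"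
proof -
  have "(AE z in kernel_measure p k. P z) \<longleftrightarrow> (AE z in lborel. 0 < ennreal (pair_weight p k z) \<longrightarrow> P z)"
    unfolding kernel_measure_def using measurable_pair_weight[OF assms]
    by (subst AE_density) (auto simp: AE_completion_iff)
  also have "\<dots> \<longleftrightarrow> (AE z in lborel. P z)"
  proof (rule iffI)
    assume "AE z in lborel. 0 < ennreal (pair_weight p k z) \<longrightarrow> P z"
    then show "AE z in lborel. P z"
      using AE_off_diagonal by eventually_elim (simp add: pair_weight_pos[OF assms])
  qed auto
  finally show ?thesis .
qed

lemma seminorm_pow_eq:
  fixes w :: "'a::euclidean_space \<Rightarrow> real"
  assumes k: "admissible_kernel TYPE('a) p s c0 k" and w: "w \<in> borel_measurable lebesgue"
  shows "seminorm_pow p k w = (\<integral>\<^sup>+z. ennreal (\<bar>increment w z\<bar> powr p) \<partial>kernel_measure p k)"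
proof -
  note [measurable] = measurable_pair_weight[OF k] measurable_increment[OF w]
  have "(\<integral>\<^sup>+z. ennreal (\<bar>increment w z\<bar> powr p) \<partial>kernel_measure p k)
      = (\<integral>\<^sup>+z. ennreal (pair_weight p k z) * ennreal (\<bar>increment w z\<bar> powr p) \<partial>lebesgue)"
    unfolding kernel_measure_def by (rule nn_integral_density) measurable
  also have "\<dots> = seminorm_pow p k w"
    unfolding seminorm_pow_def case_prod_unfold pair_weight_def increment_def
    using pair_weight_nonneg[OF k] by (intro nn_integral_cong) (simp add: pair_weight_def flip: ennreal_mult'')
  finally show ?thesis ..
qed

lemma B_form_eq:
  fixes h :: "'a::euclidean_space \<times> 'a \<Rightarrow> real"
  assumes k: "admissible_kernel TYPE('a) p s c0 k" and h: "h \<in> borel_measurable lebesgue"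
    and u: "u \<in> borel_measurable lebesgue" and v: "v \<in> borel_measurable lebesgue"
  shows "B_form p k h u v
    = (LINT z|kernel_measure p k. h z * (p_flux p (increment u z) * increment v z))"
proof -
  note [measurable] = measurable_pair_weight[OF k] measurable_increment[OF u] measurable_increment[OF v] h
  have "(LINT z|kernel_measure p k. h z * (p_flux p (increment u z) * increment v z))
      = (LINT z|lebesgue. pair_weight p k z *\<^sub>R (h z * (p_flux p (increment u z) * increment v z)))"
    unfolding kernel_measure_def
    by (rule integral_density) (measurable, simp add: pair_weight_nonneg[OF k])
  also have "\<dots> = B_form p k h u v"
    unfolding B_form_def case_prod_unfold pair_weight_def increment_def p_flux_def
    by (intro Bochner_Integration.integral_cong) (simp_all add: mult_ac)
  finally show ?thesis ..
qed

text \<open>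
  The lower bound on the kernel, divided by \<open>|z| powr p\<close>. It is stated for any representative \<open>v\<close> of \<open>w\<close>, because the
  compactness theorem is applied to Borel representatives.
\<close>

lemma gagliardo_le_seminorm_pow:
  fixes w v :: "'a::euclidean_space \<Rightarrow> real"
  assumes k: "admissible_kernel TYPE('a) p s c0 k" and c0: "0 < c0"
    and w: "w \<in> borel_measurable lebesgue" and vw: "AE x in lborel. v x = w x"
  shows "gagliardo (real DIM('a) + s * p) p v \<le> ennreal (1 / c0) * seminorm_pow p k w"
proof -
  note [measurable] = measurable_pair_weight[OF k] measurable_increment[OF w]
  have "gagliardo (real DIM('a) + s * p) p v \<le>
      (\<integral>\<^sup>+z. ennreal (1 / c0) * ennreal (\<bar>increment w z\<bar> powr p) \<partial>kernel_measure p k)"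
  proof -
    have "gagliardo (real DIM('a) + s * p) p v
        \<le> (\<integral>\<^sup>+z. ennreal (pair_weight p k z) * (ennreal (1 / c0) * ennreal (\<bar>increment w z\<bar> powr p)) \<partial>lebesgue)"
      unfolding gagliardo_def case_prod_unfold nn_integral_completion
    proof (rule nn_integral_mono_AE)
      show "AE z in lborel. ennreal (\<bar>v (fst z) - v (snd z)\<bar> powr p / norm (fst z - snd z) powr (real DIM('a) + s * p))
          \<le> ennreal (pair_weight p k z) * (ennreal (1 / c0) * ennreal (\<bar>increment w z\<bar> powr p))"
        using AE_fst_snd[OF vw] AE_off_diagonal
      proof eventually_elim
        case (elim z)
        define d where "d = norm (fst z - snd z)"
        define A where "A = \<bar>increment w z\<bar> powr p"
        have d: "0 < d" using elim by (simp add: d_def)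
        have A: "\<bar>v (fst z) - v (snd z)\<bar> powr p = A" "0 \<le> A"
          using elim by (auto simp: A_def increment_def)
        have "\<forall>y::'a. y \<noteq> 0 \<longrightarrow> c0 / norm y powr (real DIM('a) + (s - 1) * p) \<le> k (norm y)"
          using k unfolding admissible_kernel_def by blast
        from this[rule_format, of "fst z - snd z"] elim
        have "c0 / d powr (real DIM('a) + (s - 1) * p) \<le> k d" by (simp add: d_def)
        then have "c0 / d powr (real DIM('a) + (s - 1) * p) / d powr p \<le> k d / d powr p"
          by (rule divide_right_mono) simp
        also have "c0 / d powr (real DIM('a) + (s - 1) * p) / d powr p = c0 / d powr (real DIM('a) + s * p)"
          by (simp add: algebra_simps flip: powr_add)
        finally have "A * (c0 / d powr (real DIM('a) + s * p)) \<le> A * pair_weight p k z"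
          unfolding pair_weight_def d_def[symmetric] using A by (intro mult_left_mono)
        then have "A / d powr (real DIM('a) + s * p) \<le> pair_weight p k z * (1 / c0 * A)"
          using c0 by (simp add: field_simps)
        then have "ennreal (A / d powr (real DIM('a) + s * p)) \<le> ennreal (pair_weight p k z * (1 / c0 * A))"
          by (rule ennreal_leI)
        also have "\<dots> = ennreal (pair_weight p k z) * (ennreal (1 / c0) * ennreal A)"
          using ennreal_mult[OF pair_weight_nonneg[OF k, of z], of "1 / c0 * A"] ennreal_mult[of "1 / c0" A] c0 A
          by simp
        finally show ?case unfolding A(1) d_def A_def[symmetric] .
      qed
    qed
    also have "\<dots> = (\<integral>\<^sup>+z. ennreal (1 / c0) * ennreal (\<bar>increment w z\<bar> powr p) \<partial>kernel_measure p k)"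
      unfolding kernel_measure_def by (rule nn_integral_density[symmetric]) measurable
    finally show ?thesis .
  qed
  also have "\<dots> = ennreal (1 / c0) * seminorm_pow p k w"
  proof -
    have [measurable]: "increment w \<in> borel_measurable (kernel_measure p k)" by simp
    show ?thesis unfolding seminorm_pow_eq[OF k w] by (rule nn_integral_cmult) measurable
  qed
  finally show ?thesis .
qed

lemma X0_measurable: "w \<in> X0_space p k \<Omega> \<Longrightarrow> w \<in> borel_measurable lebesgue"
  by (simp add: X0_space_def X_space_def Lp_space_def)

lemma X0_increment:
  fixes w :: "'a::euclidean_space \<Rightarrow> real"
  assumes k: "admissible_kernel TYPE('a) p s c0 k" and w: "w \<in> X0_space p k \<Omega>"
  shows "integrable (kernel_measure p k) (\<lambda>z. \<bar>increment w z\<bar> powr p)"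
    and "(LINT z|kernel_measure p k. \<bar>increment w z\<bar> powr p) = enn2real (seminorm_pow p k w)"
proof -
  note [measurable] = measurable_increment[OF X0_measurable[OF w]]
  note eq = seminorm_pow_eq[OF k X0_measurable[OF w]]
  have "seminorm_pow p k w < \<infinity>" using w by (simp add: X0_space_def X_space_def)
  then show "integrable (kernel_measure p k) (\<lambda>z. \<bar>increment w z\<bar> powr p)"
    unfolding eq by (intro integrableI_nonneg) auto
  show "(LINT z|kernel_measure p k. \<bar>increment w z\<bar> powr p) = enn2real (seminorm_pow p k w)"
    unfolding eq by (rule integral_eq_nn_integral) auto
qed

lemma X0_borel_representative:
  fixes w :: "'a::euclidean_space \<Rightarrow> real"
  assumes "w \<in> X0_space p k \<Omega>" and [measurable]: "\<Omega> \<in> sets borel"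
  obtains v where "v \<in> borel_measurable borel" "\<And>x. x \<notin> \<Omega> \<Longrightarrow> v x = 0" "AE x in lborel. v x = w x"
proof -
  from completion_ex_borel_measurable_real[OF X0_measurable[OF assms(1)]]
  obtain g where [measurable]: "g \<in> borel_measurable lborel" and g: "AE x in lborel. w x = g x" by blast
  have [measurable]: "g \<in> borel_measurable borel" using \<open>g \<in> borel_measurable lborel\<close> by simp
  have "AE x in lborel. x \<notin> \<Omega> \<longrightarrow> w x = 0"
    using assms(1) by (simp add: X0_space_def AE_completion_iff)
  with g have "AE x in lborel. indicator \<Omega> x * g x = w x"
    by eventually_elim (auto simp: indicator_def)
  then show ?thesis by (intro that[of "\<lambda>x. indicator \<Omega> x * g x"]) auto
qed

text \<open>
  Turns \<open>hmin * B(u\<^sub>j,u\<^sub>j) \<le> \<langle>f, u\<^sub>j\<rangle> \<le> C B(u\<^sub>j,u\<^sub>j) powr (1 / p)\<close> into an a priori bound.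
\<close>

lemma le_powr_of_le_root:
  fixes t :: real
  assumes "1 < p" "0 < b" "0 \<le> t" "b * t \<le> c * t powr (1 / p)"
  shows "t \<le> (\<bar>c\<bar> / b) powr (p / (p - 1))"
proof (cases "t = 0")
  case False
  then have t: "0 < t" using assms by simp
  have "t powr ((p - 1) / p) * t powr (1 / p) = t"
    using t assms by (simp add: field_simps flip: powr_add)
  then have "b * t powr ((p - 1) / p) * t powr (1 / p) \<le> \<bar>c\<bar> * t powr (1 / p)"
    using assms(4) by (metis abs_ge_self mult.assoc mult_right_mono order_trans powr_ge_zero)
  then have "t powr ((p - 1) / p) \<le> \<bar>c\<bar> / b"
    using t assms by (simp add: field_simps)
  then have "(t powr ((p - 1) / p)) powr (p / (p - 1)) \<le> (\<bar>c\<bar> / b) powr (p / (p - 1))"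
    using assms by (intro powr_mono2) auto
  then show ?thesis using t assms by (simp add: powr_powr)
qed simp

section \<open>Convergence of the solutions and of the minima\<close>

theorem theorem2:
  fixes \<Omega> :: "'a::euclidean_space set"
    and p s c0 hmin hmax :: real
    and k :: "real \<Rightarrow> real"
    and f :: "('a \<Rightarrow> real) \<Rightarrow> real"
    and hj :: "nat \<Rightarrow> 'a \<times> 'a \<Rightarrow> real"
    and h :: "'a \<times> 'a \<Rightarrow> real"
    and uj :: "nat \<Rightarrow> 'a \<Rightarrow> real"
    and u :: "'a \<Rightarrow> real"
  assumes "bounded \<Omega>" and "smooth_domain \<Omega>"
    and "1 < p" and "0 < s" and "s < 1" and "0 < c0"
    and "admissible_kernel TYPE('a) p s c0 k"
    and "0 < hmin" and "hmin < hmax"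
    and "f \<in> X0_dual p k \<Omega>"
    and "\<And>j. hj j \<in> H_class hmin hmax" and "h \<in> H_class hmin hmax"
    and "weak_star_Linf hj h"
    and "\<And>j. is_solution p k \<Omega> (hj j) f (uj j)"
    and "is_solution p k \<Omega> h f u"
  shows "\<exists>r :: nat \<Rightarrow> nat. strict_mono r \<and>
           (\<lambda>j. Lp_norm p (\<lambda>x. uj (r j) x - u x)) \<longlonglongrightarrow> 0 \<and>
           (\<exists>mj m. (\<forall>j. is_minimum (energy p k (hj j) f) (X0_space p k \<Omega>) (mj j)) \<and>
                   is_minimum (energy p k h f) (X0_space p k \<Omega>) m \<and>
                   (\<lambda>j. mj (r j)) \<longlonglongrightarrow> m) \<and>
           (\<lambda>j. B_form p k (hj (r j)) (uj (r j)) (uj (r j))) \<longlonglongrightarrow> B_form p k h u u"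
proof -
  note p = assms(3) and c0 = assms(6) and k = assms(7) and hmin = assms(8) and weak_star = assms(13)
  define M :: "('a \<times> 'a) measure" where "M = kernel_measure p k"
  note AE_M = AE_kernel_measure_iff[OF k, folded M_def]
  note B_form = B_form_eq[OF k, folded M_def]
  have \<Omega> [measurable]: "\<Omega> \<in> sets borel" using assms(2) by (simp add: smooth_domain_def)
  have u: "u \<in> X0_space p k \<Omega>" and uj: "\<And>j. uj j \<in> X0_space p k \<Omega>"
    and sol: "\<And>v. v \<in> X0_space p k \<Omega> \<Longrightarrow> B_form p k h u v = f v"
    and solj: "\<And>j v. v \<in> X0_space p k \<Omega> \<Longrightarrow> B_form p k (hj j) (uj j) v = f v"
    using assms(14,15) by (auto simp: is_solution_def)
  have H: "g \<in> borel_measurable lebesgue" "AE z in M. hmin \<le> g z \<and> g z \<le> hmax"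
    if "g \<in> H_class hmin hmax" for g
  proof -
    show "g \<in> borel_measurable lebesgue" using that by (simp add: H_class_def Linf_space_def)
    have "AE z in lborel. hmin \<le> g z \<and> g z \<le> hmax"
      using that by (auto simp: H_class_def case_prod_unfold AE_completion_iff)
    then show "AE z in M. hmin \<le> g z \<and> g z \<le> hmax" by (simp add: AE_M)
  qed
  have M_meas: "g \<in> borel_measurable M" if "g \<in> borel_measurable lebesgue" for g :: "'a \<times> 'a \<Rightarrow> real"
    using that by (simp add: M_def)
  note h = M_meas[OF H(1)[OF assms(12)]] H(2)[OF assms(12)]
  note hj = M_meas[OF H(1)[OF assms(11)]] H(2)[OF assms(11)]
  have inc: "increment w \<in> borel_measurable M" "integrable M (\<lambda>z. \<bar>increment w z\<bar> powr p)"
    "(LINT z|M. \<bar>increment w z\<bar> powr p) = enn2real (seminorm_pow p k w)"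
    if "w \<in> X0_space p k \<Omega>" for w
    using M_meas[OF measurable_increment[OF X0_measurable[OF that]]] X0_increment[OF k that]
    by (simp_all add: M_def)
  have minimal: "is_minimum (energy p k g f) (X0_space p k \<Omega>) (1 / p * f v - f v)"
    if g: "g \<in> H_class hmin hmax" and v: "v \<in> X0_space p k \<Omega>"
      and sol_v: "\<And>w. w \<in> X0_space p k \<Omega> \<Longrightarrow> B_form p k g v w = f w" for g v
    unfolding is_minimum_def
  proof (intro conjI ballI bexI[OF _ v])
    show "energy p k g f v = 1 / p * f v - f v" by (simp add: energy_def sol_v[OF v])
    fix w assume w: "w \<in> X0_space p k \<Omega>"
    have "AE z in M. 0 \<le> g z \<and> g z \<le> hmax"
      using H(2)[OF g] by eventually_elim (use hmin in auto)
    from flux_test_energy_le[OF p inc(1)[OF v] inc(1)[OF w] M_meas[OF H(1)[OF g]] this inc(2)[OF v] inc(2)[OF w]]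
    show "1 / p * f v - f v \<le> energy p k g f w"
      unfolding energy_def B_form[OF H(1)[OF g] X0_measurable[OF v] X0_measurable[OF v], symmetric]
        B_form[OF H(1)[OF g] X0_measurable[OF v] X0_measurable[OF w], symmetric]
        B_form[OF H(1)[OF g] X0_measurable[OF w] X0_measurable[OF w], symmetric]
        sol_v[OF v] sol_v[OF w] .
  qed

  obtain Cf where Cf: "\<And>w. w \<in> X0_space p k \<Omega> \<Longrightarrow> \<bar>f w\<bar> \<le> Cf * X0_norm p k w"
    using assms(10) unfolding X0_dual_def by blast
  define C where "C = (\<bar>Cf\<bar> / hmin) powr (p / (p - 1))"
  have bound: "(LINT z|M. \<bar>increment (uj j) z\<bar> powr p) \<le> C" for j
    unfolding C_def
  proof (rule le_powr_of_le_root[OF p hmin])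
    note w = uj[of j] and hjj = H[OF assms(11)[of j]]
    show "0 \<le> (LINT z|M. \<bar>increment (uj j) z\<bar> powr p)" by (rule integral_nonneg_AE) simp
    have D: "AE z in M. \<bar>hj j z\<bar> \<le> hmax"
      using hjj(2) by eventually_elim (use hmin in auto)
    have "hmin * (LINT z|M. \<bar>increment (uj j) z\<bar> powr p) = (LINT z|M. hmin * \<bar>increment (uj j) z\<bar> powr p)"
      by simp
    also have "\<dots> \<le> (LINT z|M. hj j z * \<bar>increment (uj j) z\<bar> powr p)"
    proof (rule integral_mono_AE)
      show "AE z in M. hmin * \<bar>increment (uj j) z\<bar> powr p \<le> hj j z * \<bar>increment (uj j) z\<bar> powr p"
        using hjj(2) by eventually_elim (simp add: mult_right_mono)
    qed (use inc[OF w] hj D in \<open>auto intro: integrable_bounded_mult\<close>)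
    also have "\<dots> = f (uj j)"
      using B_form[OF hjj(1) X0_measurable[OF w] X0_measurable[OF w]] solj[OF w]
      by (simp add: p_flux_mult_self)
    also have "\<dots> \<le> Cf * X0_norm p k (uj j)" using Cf[OF w] by simp
    also have "\<dots> = Cf * (LINT z|M. \<bar>increment (uj j) z\<bar> powr p) powr (1 / p)"
      by (simp add: X0_norm_def inc(3)[OF w])
    finally show "hmin * (LINT z|M. \<bar>increment (uj j) z\<bar> powr p)
      \<le> Cf * (LINT z|M. \<bar>increment (uj j) z\<bar> powr p) powr (1 / p)" .
  qed

  define a where "a = real DIM('a) + s * p"
  have a: "real DIM('a) < a" "0 \<le> a" using assms(4) p by (simp_all add: a_def)
  have "\<exists>v. v \<in> borel_measurable borel \<and> (\<forall>x. x \<notin> \<Omega> \<longrightarrow> v x = 0) \<and> (AE x in lborel. v x = uj j x)" for j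
    using X0_borel_representative[OF uj \<Omega>] by metis
  then obtain wj where wj: "\<And>j. wj j \<in> borel_measurable borel" "\<And>j x. x \<notin> \<Omega> \<Longrightarrow> wj j x = 0"
    "\<And>j. AE x in lborel. wj j x = uj j x" by metis
  obtain w where w: "w \<in> borel_measurable borel" "\<And>x. x \<notin> \<Omega> \<Longrightarrow> w x = 0" "AE x in lborel. w x = u x"
    using X0_borel_representative[OF u \<Omega>] by metis
  have gag: "gagliardo a p (wj j) \<le> ennreal (1 / c0 * C)" for j
  proof -
    have "seminorm_pow p k (uj j) < top" using uj[of j] by (simp add: X0_space_def X_space_def)
    then have "seminorm_pow p k (uj j) \<le> ennreal C"
      using bound[of j] unfolding inc(3)[OF uj] by (metis ennreal_enn2real ennreal_leI)
    from mult_left_mono[OF this, of "ennreal (1 / c0)"]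
    have "ennreal (1 / c0) * seminorm_pow p k (uj j) \<le> ennreal (1 / c0 * C)"
      using ennreal_mult'[of "1 / c0" C] c0 by simp
    with gagliardo_le_seminorm_pow[OF k c0 X0_measurable[OF uj] wj(3)] show ?thesis
      unfolding a_def by (rule order_trans)
  qed
  have "\<exists>r v. strict_mono (r :: nat \<Rightarrow> nat) \<and> v \<in> borel_measurable lborel \<and>
      (AE x in lborel. (\<lambda>j. wj (r j) x) \<longlonglongrightarrow> v x) \<and>
      (\<lambda>j. \<integral>\<^sup>+x. ennreal (\<bar>wj (r j) x - v x\<bar> powr p) \<partial>lborel) \<longlonglongrightarrow> 0"
    by (rule gagliardo_compact[OF p a(1) \<Omega> assms(1) _ _ gag]) (use wj in auto)
  then obtain r v where r: "strict_mono (r :: nat \<Rightarrow> nat)" and v: "v \<in> borel_measurable lborel"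
    and lim: "AE x in lborel. (\<lambda>j. wj (r j) x) \<longlonglongrightarrow> v x"
    and Lp: "(\<lambda>j. \<integral>\<^sup>+x. ennreal (\<bar>wj (r j) x - v x\<bar> powr p) \<partial>lborel) \<longlonglongrightarrow> 0"
    by (elim exE conjE) (rule that)
  have [measurable]: "v \<in> borel_measurable borel" "w \<in> borel_measurable borel" "\<And>j. wj j \<in> borel_measurable borel"
    by (use v w(1) wj(1) in simp_all)
  have v0: "AE x in lborel. x \<notin> \<Omega> \<longrightarrow> v x = 0"
    using lim by eventually_elim (auto simp: wj(2) intro: LIMSEQ_unique[OF _ tendsto_const])
  have "AE x in lborel. \<forall>j. wj j x = uj j x" using wj(3) by (simp add: AE_all_countable)
  with lim have "AE x in lborel. (\<lambda>j. uj (r j) x) \<longlonglongrightarrow> v x" by eventually_elim simp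
  from AE_fst_snd[OF this] have limM: "AE z in M. (\<lambda>j. increment (uj (r j)) z) \<longlonglongrightarrow> increment v z"
    unfolding AE_M increment_def by eventually_elim (auto intro: tendsto_diff)

  have v_meas: "increment v \<in> borel_measurable M"
    by (intro M_meas measurable_increment measurable_completion) simp
  have weak: "(\<lambda>j. LINT z|M. hj (r j) z * \<phi> z) \<longlonglongrightarrow> (LINT z|M. h z * \<phi> z)" if \<phi>: "integrable M \<phi>" for \<phi>
  proof -
    have m: "\<phi> \<in> borel_measurable lebesgue" using borel_measurable_integrable[OF \<phi>] by (simp add: M_def)
    note [measurable] = m measurable_pair_weight[OF k]
    have "integrable lebesgue (\<lambda>z. pair_weight p k z *\<^sub>R \<phi> z)"
      using \<phi> pair_weight_nonneg[OF k] unfolding M_def kernel_measure_def by (subst (asm) integrable_density) auto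
    then have "(\<lambda>j. LINT z|lebesgue. hj j z * (pair_weight p k z *\<^sub>R \<phi> z)) \<longlonglongrightarrow> (LINT z|lebesgue. h z * (pair_weight p k z *\<^sub>R \<phi> z))"
      using weak_star by (simp add: weak_star_Linf_def)
    moreover have "(LINT z|M. g z * \<phi> z) = (LINT z|lebesgue. g z * (pair_weight p k z *\<^sub>R \<phi> z))"
      if [measurable]: "g \<in> borel_measurable lebesgue" for g
      unfolding M_def kernel_measure_def using pair_weight_nonneg[OF k]
      by (subst integral_density) (auto intro!: Bochner_Integration.integral_cong simp: mult_ac)
    ultimately have "(\<lambda>j. LINT z|M. hj j z * \<phi> z) \<longlonglongrightarrow> (LINT z|M. h z * \<phi> z)"
      using H(1)[OF assms(11)] H(1)[OF assms(12)] by simp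
    from LIMSEQ_subseq_LIMSEQ[OF this r] show ?thesis by (simp add: o_def)
  qed
  have "AE z in M. increment v z = increment u z"
  proof (rule flux_limit_identification[OF p hmin inc(1)[OF u] v_meas inc(1)[OF uj] hj(1) h(1) hj(2) h(2)
        inc(2)[OF u] inc(2)[OF uj] bound limM weak])
    fix j
    note B1 = B_form[OF H(1)[OF assms(11)] X0_measurable[OF uj], symmetric]
      and B2 = B_form[OF H(1)[OF assms(12)] X0_measurable[OF u], symmetric]
    \<comment> \<open>Both sides equal \<open>f (uj (r j))\<close>; in the next equation, \<open>f u\<close>.\<close>
    show "(LINT z|M. hj (r j) z * (p_flux p (increment (uj (r j)) z) * increment (uj (r j)) z))
        = (LINT z|M. h z * (p_flux p (increment u z) * increment (uj (r j)) z))"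
      by (simp add: B1 B2 X0_measurable[OF uj] uj sol solj)
    show "(LINT z|M. hj (r j) z * (p_flux p (increment (uj (r j)) z) * increment u z))
        = (LINT z|M. h z * (p_flux p (increment u z) * increment u z))"
      by (simp add: B1 B2 X0_measurable[OF u] u sol solj)
  qed
  then have vu: "AE z in lborel. increment v z = increment u z" by (simp add: AE_M)

  have "AE x in lborel. v x = u x"
  proof -
    \<comment> \<open>The limit \<open>v\<close> vanishes off \<open>\<Omega>\<close> only almost everywhere; the indicator makes this hold everywhere.\<close>
    define d where "d x = indicator \<Omega> x * v x - w x" for x
    have [measurable]: "d \<in> borel_measurable borel" unfolding d_def by measurable
    have d0: "\<forall>x. x \<notin> \<Omega> \<longrightarrow> d x = 0" by (simp add: d_def w(2))
    have d_eq: "AE x in lborel. d x = v x - u x"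
      using v0 w(3) by eventually_elim (auto simp: d_def indicator_def)
    have "gagliardo a p d = (\<integral>\<^sup>+z. 0 \<partial>(lborel :: ('a \<times> 'a) measure))"
      unfolding gagliardo_def
    proof (rule nn_integral_cong_AE)
      show "AE z in lborel. (case z of (x, y) \<Rightarrow> ennreal (\<bar>d x - d y\<bar> powr p / norm (x - y) powr a)) = 0"
        using AE_fst_snd[OF d_eq] vu by eventually_elim (auto simp: increment_def)
    qed
    moreover obtain K where "(\<integral>\<^sup>+x. ennreal (\<bar>d x\<bar> powr p) \<partial>lborel) \<le> ennreal K * gagliardo a p d"
      using Poincare_gagliardo[OF assms(1) a(2), of p] d0 \<open>d \<in> borel_measurable borel\<close> by blast
    ultimately have "(\<integral>\<^sup>+x. ennreal (\<bar>d x\<bar> powr p) \<partial>lborel) = 0" by simp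
    then have "AE x in lborel. ennreal (\<bar>d x\<bar> powr p) = 0"
      by (subst (asm) nn_integral_0_iff_AE) auto
    with d_eq show ?thesis by eventually_elim (simp add: ennreal_eq_0_iff)
  qed
  have Lp_lim: "(\<lambda>j. Lp_norm p (\<lambda>x. uj (r j) x - u x)) \<longlonglongrightarrow> 0"
  proof -
    have "Lp_norm p (\<lambda>x. uj (r j) x - u x)
        = enn2real (\<integral>\<^sup>+x. ennreal (\<bar>wj (r j) x - v x\<bar> powr p) \<partial>lborel) powr (1 / p)" for j
    proof -
      note [measurable] = X0_measurable[OF u] X0_measurable[OF uj]
      have "(LINT x|lebesgue. \<bar>uj (r j) x - u x\<bar> powr p)
          = enn2real (\<integral>\<^sup>+x. ennreal (\<bar>uj (r j) x - u x\<bar> powr p) \<partial>lebesgue)"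
        by (rule integral_eq_nn_integral) auto
      also have "(\<integral>\<^sup>+x. ennreal (\<bar>uj (r j) x - u x\<bar> powr p) \<partial>lebesgue)
          = (\<integral>\<^sup>+x. ennreal (\<bar>wj (r j) x - v x\<bar> powr p) \<partial>lborel)"
        unfolding nn_integral_completion
      proof (rule nn_integral_cong_AE)
        show "AE x in lborel. ennreal (\<bar>uj (r j) x - u x\<bar> powr p) = ennreal (\<bar>wj (r j) x - v x\<bar> powr p)"
          using \<open>AE x in lborel. v x = u x\<close> wj(3)[of "r j"] by eventually_elim simp
      qed
      finally show ?thesis by (simp add: Lp_norm_def)
    qed
    moreover have "(\<lambda>j. enn2real (\<integral>\<^sup>+x. ennreal (\<bar>wj (r j) x - v x\<bar> powr p) \<partial>lborel) powr (1 / p)) \<longlonglongrightarrow> 0 powr (1 / p)"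
      using p by (intro tendsto_powr' tendsto_const tendsto_enn2real[OF _ _, of _ 0, simplified] Lp) auto
    ultimately show ?thesis by simp
  qed

  have f_lim: "(\<lambda>j. f (uj (r j))) \<longlonglongrightarrow> f u"
  proof -
    have hD: "AE z in M. \<bar>h z\<bar> \<le> hmax" using h(2) by eventually_elim (use hmin in auto)
    have limu: "AE z in M. (\<lambda>j. increment (uj (r j)) z) \<longlonglongrightarrow> increment u z"
      using limM vu[folded AE_M] by eventually_elim simp
    have diff: "(LINT z|M. h z * (p_flux p (increment u z) * (increment (uj (r j)) z - increment u z)))
        = f (uj (r j)) - f u" for j
    proof -
      have int: "integrable M (\<lambda>z. h z * (p_flux p (increment u z) * increment y z))"
        if y: "y \<in> X0_space p k \<Omega>" for y
        by (rule integrable_bounded_mult[OF integrable_flux_mult[OF p inc(1)[OF u] inc(1)[OF y] inc(2)[OF u] inc(2)[OF y]] h(1) hD])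
      have eq: "(LINT z|M. h z * (p_flux p (increment u z) * increment y z)) = f y"
        if y: "y \<in> X0_space p k \<Omega>" for y
        using B_form[OF H(1)[OF assms(12)] X0_measurable[OF u] X0_measurable[OF y]] sol[OF y] by simp
      show ?thesis
        using Bochner_Integration.integral_diff[OF int[OF uj] int[OF u]]
        by (simp add: right_diff_distrib eq uj u)
    qed
    have "(\<lambda>j. f (uj (r j)) - f u) \<longlonglongrightarrow> 0"
      unfolding diff[symmetric]
      by (rule tendsto_integral_flux_mult[OF p inc(1)[OF u] inc(1)[OF u] inc(1)[OF uj] h(1) hD
            inc(2)[OF u] inc(2)[OF uj] bound limu])
    then show ?thesis by (simp add: LIM_zero_iff)
  qed
  show ?thesis
  proof (intro exI[of _ r] conjI r Lp_lim exI[of _ "\<lambda>j. 1 / p * f (uj j) - f (uj j)"]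
      exI[of _ "1 / p * f u - f u"] allI)
    show "is_minimum (energy p k (hj j) f) (X0_space p k \<Omega>) (1 / p * f (uj j) - f (uj j))" for j
      by (rule minimal[OF assms(11) uj solj])
    show "is_minimum (energy p k h f) (X0_space p k \<Omega>) (1 / p * f u - f u)"
      by (rule minimal[OF assms(12) u sol])
    show "(\<lambda>j. 1 / p * f (uj (r j)) - f (uj (r j))) \<longlonglongrightarrow> 1 / p * f u - f u"
      by (intro tendsto_intros f_lim)
    show "(\<lambda>j. B_form p k (hj (r j)) (uj (r j)) (uj (r j))) \<longlonglongrightarrow> B_form p k h u u"
      using f_lim by (simp add: sol solj u uj)
  qed
qed

end
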